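(* Let $C$ be a bivariate copula with $\tau(C)=\tau$. Then \[ 0\leqslant\mu_\infty(C)\leqslant\begin{cases}\sqrt{\dfrac{1+\tau}{4}}, & -1\leqslant\tau\leqslant-\frac59,\\[2mm] \dfrac13, & -\frac59\leqslant\tau\leqslant\frac19,\\[2mm] \sqrt{\dfrac{1-\tau}{8}}, & \frac19\leqslant\tau\leqslant1,\end{cases} \] and the bounds are attained (for each $\tau\in[-1,1]$, both the lower and the upper bound are attained by some copula $C$ with $\tau(C)=\tau$).
   Context: For a bivariate copula $C$, the measure of asymmetry is $\mu_\infty(C)=\max_{u,v\in[0,1]}|C(u,v)-C(v,u)|$. For copulas $C_1,C_2$ the concordance function is $\mathcal{Q}(C_1,C_2)=4\int_{[0,1]^2}C_2(u,v)\,dC_1(u,v)-1$. Kendall's tau is $\tau(C)=\mathcal{Q}(C,C)$. *)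

theory Defs
  imports "HOL-Analysis.Analysis"
begin

text \<open>
  A bivariate copula is a function on the unit square. It is represented by a total function
  on the plane; its values outside the unit square are unconstrained and are never used.
\<close>

definition unit_square :: "(real \<times> real) set" where
  "unit_square = {0..1} \<times> {0..1}"

definition copula :: "(real \<Rightarrow> real \<Rightarrow> real) \<Rightarrow> bool" where
  "copula C \<longleftrightarrow>
     (\<forall>t\<in>{0..1}. C t 0 = 0 \<and> C 0 t = 0 \<and> C t 1 = t \<and> C 1 t = t) \<and>
     (\<forall>u1 u2 v1 v2. 0 \<le> u1 \<and> u1 \<le> u2 \<and> u2 \<le> 1 \<and> 0 \<le> v1 \<and> v1 \<le> v2 \<and> v2 \<le> 1 \<longrightarrow>
        0 \<le> C u2 v2 - C u2 v1 - C u1 v2 + C u1 v1)"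

text \<open>
  The Borel probability measure with distribution function \<open>C\<close>. For a copula \<open>C\<close>
  it exists and is unique, because \<open>C\<close> is continuous and 2-increasing on the unit square.
\<close>

definition copula_measure :: "(real \<Rightarrow> real \<Rightarrow> real) \<Rightarrow> (real \<times> real) measure" where
  "copula_measure C = (THE M. sets M = sets borel \<and>
     emeasure M (- unit_square) = 0 \<and>
     (\<forall>u\<in>{0..1}. \<forall>v\<in>{0..1}. emeasure M ({0..u} \<times> {0..v}) = ennreal (C u v)))"

definition concordance :: "(real \<Rightarrow> real \<Rightarrow> real) \<Rightarrow> (real \<Rightarrow> real \<Rightarrow> real) \<Rightarrow> real" where
  "concordance C1 C2 = 4 * (LINT (u, v):unit_square|copula_measure C1. C2 u v) - 1"

definition kendall_tau :: "(real \<Rightarrow> real \<Rightarrow> real) \<Rightarrow> real" where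
  "kendall_tau C = concordance C C"

text \<open>
  The supremum is a maximum for every copula \<open>C\<close>, since copulas are continuous on the
  compact unit square.
\<close>

definition asymmetry :: "(real \<Rightarrow> real \<Rightarrow> real) \<Rightarrow> real" where
  "asymmetry C = (SUP (u, v)\<in>unit_square. \<bar>C u v - C v u\<bar>)"

text \<open>
  Only arguments in \<open>{-1..1}\<close> are relevant. Neighbouring branches agree at \<open>-5/9\<close> and
  at \<open>1/9\<close>.
\<close>

definition asymmetry_bound :: "real \<Rightarrow> real" where
  "asymmetry_bound t =
     (if t \<le> -5/9 then sqrt ((1 + t) / 4)
      else if t \<le> 1/9 then 1/3
      else sqrt ((1 - t) / 8))"

end

(*
  Everything rests on two estimates for a copula C and a point (a, b). Integrating C over the
  rectangle to the upper right of (a, b), where C >= C(a, b), gives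
  tau(C) >= 4 C(a, b) (1 - a - b + C(a, b)) - 1; integrating v - C(u, v), whose C-mean is
  1/2 minus that of C, over the rectangle to the upper left of (a, b) gives
  tau(C) <= 1 - 4 (a - C(a, b)) (b - C(a, b)).
  If C(a, b) - C(b, a) = d >= 0, monotonicity and the Lipschitz property turn these into
  4 d^2 - 1 <= tau(C) <= 1 - 8 d^2 together with d <= 1/3. The extreme values of tau are attained
  by two families of shuffles with three pieces. The middle range, and symmetric copulas
  with prescribed tau, are obtained from mixtures of two such shuffles, because tau
  is a quadratic polynomial along a segment of copulas.
*)

theory Submission
  imports Defs "HOL-Probability.Probability"
begin

section \<open>Measures with a Lipschitz distribution function on the plane\<close>

text \<open>The measure of a copula is given by a definite description, so no integral can be
  estimated before existence and uniqueness are proved. Existence amounts to countable additivity of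
  rectangle masses, which the Lipschitz property yields through compactness.

  The two estimates use d differently. The upper one is taken at (b, a), where C has the smaller
  value; because |a - b| >= d, one factor is at least 2 d and the other at least d, hence 8 d^2. The
  lower one is taken at (a, b), where both factors are bounded below by d, hence 4 d^2. The limit
  1/3 comes from a + (b - a) + (1 - b) = 1 for a <= b, with d at most each summand. The breakpoints
  -5/9 and 1/9 are the values of 4 d^2 - 1 and 1 - 8 d^2 at d = 1/3. For this d both families of
  shuffles reach the difference 1/3 at the same point (1/3, 2/3), so mixing them moves tau and keeps
  the asymmetry.\<close>

lemma semiring_of_sets_Ioc: "semiring_of_sets UNIV {{a<..b} |a b :: real. a \<le> b}"
proof (unfold_locales, safe)
  fix a b c d :: real assume *: "a \<le> b" "c \<le> d"
  show "\<exists>C\<subseteq>{{a<..b} |a b. a \<le> b}. finite C \<and> disjoint C \<and> {a<..b} - {c<..d} = \<Union>C"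
  proof (intro exI conjI)
    let ?D = "if b \<le> c \<or> d \<le> a \<or> d \<le> c then {{a<..b}} else {{a<..max a c}, {min b d<..b}}"
    show "?D \<subseteq> {{a<..b} |a b. a \<le> b}"
    proof -
      have "{x<..y} \<in> {{a<..b} |a b. a \<le> b}" if "x \<le> y" for x y :: real
        using that by blast
      then show ?thesis
        using * by (simp del: mem_Collect_eq)
    qed
    show "finite ?D"
      by auto
    show "disjoint ?D"
      using * by (auto simp: disjoint_def disjnt_def)
    show "{a<..b} - {c<..d} = \<Union>?D"
      using * by auto
  qed
next
  fix a b c d :: real assume *: "a \<le> b" "c \<le> d"
  show "\<exists>e f. {a<..b} \<inter> {c<..d} = {e<..f} \<and> e \<le> f"
    \<comment> \<open>The outer \<open>max\<close> keeps the endpoints ordered when the intervals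
      are disjoint.\<close>
    by (rule exI[of _ "max a c"], rule exI[of _ "max (max a c) (min b d)"]) auto
qed auto

lemma semiring_of_sets_Times:
  assumes M: "semiring_of_sets \<Omega> M" and N: "semiring_of_sets \<Omega>' N"
  shows "semiring_of_sets (\<Omega> \<times> \<Omega>') {A \<times> B | A B. A \<in> M \<and> B \<in> N}"
proof -
  interpret M: semiring_of_sets \<Omega> M by fact
  interpret N: semiring_of_sets \<Omega>' N by fact
  show ?thesis
  proof (unfold_locales)
    show "{A \<times> B | A B. A \<in> M \<and> B \<in> N} \<subseteq> Pow (\<Omega> \<times> \<Omega>')"
      using M.sets_into_space N.sets_into_space by blast
    show "{} \<in> {A \<times> B | A B. A \<in> M \<and> B \<in> N}"
      by auto
  next
    fix X Y assume "X \<in> {A \<times> B | A B. A \<in> M \<and> B \<in> N}" "Y \<in> {A \<times> B | A B. A \<in> M \<and> B \<in> N}"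
    then obtain A B C D where X: "X = A \<times> B" "A \<in> M" "B \<in> N" and Y: "Y = C \<times> D" "C \<in> M" "D \<in> N"
      by auto
    show "X \<inter> Y \<in> {A \<times> B | A B. A \<in> M \<and> B \<in> N}"
      using X Y by (auto simp: Times_Int_Times)
    obtain S where S: "S \<subseteq> M" "finite S" "disjoint S" "A - C = \<Union>S"
      using M.Diff_cover[OF X(2) Y(2)] by auto
    obtain T where T: "T \<subseteq> N" "finite T" "disjoint T" "B - D = \<Union>T"
      using N.Diff_cover[OF X(3) Y(3)] by auto
    \<comment> \<open>The difference is the disjoint union of (A - C) x B and (A Int C) x (B - D);
      each is cut into strips by the cover of its factor.\<close>
    let ?Z = "(\<lambda>P. P \<times> B) ` S \<union> (\<lambda>Q. (A \<inter> C) \<times> Q) ` T"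
    have SA: "P \<inter> C = {}" if "P \<in> S" for P
      using S(4) that by auto
    have "disjoint ?Z"
    proof (rule disjoint_union)
      show "disjoint ((\<lambda>P. P \<times> B) ` S)"
      proof (rule disjointI)
        fix P Q assume "P \<in> (\<lambda>P. P \<times> B) ` S" "Q \<in> (\<lambda>P. P \<times> B) ` S" "P \<noteq> Q"
        then show "P \<inter> Q = {}"
          using disjointD[OF S(3)] by (auto simp: Times_Int_Times)
      qed
      show "disjoint ((\<lambda>Q. (A \<inter> C) \<times> Q) ` T)"
      proof (rule disjointI)
        fix P Q assume "P \<in> (\<lambda>Q. (A \<inter> C) \<times> Q) ` T" "Q \<in> (\<lambda>Q. (A \<inter> C) \<times> Q) ` T" "P \<noteq> Q"
        then show "P \<inter> Q = {}"
          using disjointD[OF T(3)] by (auto simp: Times_Int_Times)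
      qed
      show "\<Union>((\<lambda>P. P \<times> B) ` S) \<inter> \<Union>((\<lambda>Q. (A \<inter> C) \<times> Q) ` T) = {}"
        using SA by blast
    qed
    moreover have "?Z \<subseteq> {A \<times> B | A B. A \<in> M \<and> B \<in> N}"
      using S(1) T(1) X Y by blast
    moreover have "X - Y = \<Union>?Z"
    proof -
      have "X - Y = (A - C) \<times> B \<union> (A \<inter> C) \<times> (B - D)"
        using X Y by auto
      then show ?thesis
        unfolding S(4) T(4) by auto
    qed
    ultimately show "\<exists>Z\<subseteq>{A \<times> B | A B. A \<in> M \<and> B \<in> N}. finite Z \<and> disjoint Z \<and> X - Y = \<Union>Z"
      using S(2) T(2) by (intro exI[of _ ?Z]) auto
  qed
qed

section \<open>Finite additivity of rectangle masses through grids\<close>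

definition rect :: "(real \<Rightarrow> real \<Rightarrow> real) \<Rightarrow> real \<Rightarrow> real \<Rightarrow> real \<Rightarrow> real \<Rightarrow> real" where
  "rect F a b c d = F b d - F b c - F a d + F a c"

text \<open>Each grid point in (a, b] carries the increment to its right neighbour. The indices
  involved run from floor(N a) + 1 to floor(N b), so both ends are moved by the same rule, to the
  first grid point strictly to their right.\<close>

lemma grid_telescope:
  fixes g :: "real \<Rightarrow> real" and a b :: real and N :: nat and L :: int
  assumes N: "N > 0" and ab: "a \<le> b" and L: "real N * \<bar>a\<bar> + 1 \<le> L" "real N * \<bar>b\<bar> + 1 \<le> L"
  shows "(\<Sum>i\<in>{-L..L}. (g (real_of_int (i + 1) / N) - g (i / N)) * indicator {a<..b} (i / N)) =
    g ((\<lfloor>N * b\<rfloor> + 1) / N) - g ((\<lfloor>N * a\<rfloor> + 1) / N)"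
proof -
  have tele: "(\<Sum>i\<in>{m<..n}. h (i + 1) - h i) = h (n + 1) - h (m + 1)" if "m \<le> n"
    for m n :: int and h :: "int \<Rightarrow> real"
    using that
  proof (induction n rule: int_ge_induct)
    case (step n)
    have "{m<..n + 1} = insert (n + 1) {m<..n}"
      using step(1) by auto
    with step show ?case by simp
  qed simp
  have iff: "real_of_int i / N \<in> {a<..b} \<longleftrightarrow> i \<in> {\<lfloor>N * a\<rfloor><..\<lfloor>N * b\<rfloor>}" for i
    using N by (auto simp: field_simps floor_less_iff le_floor_iff)
  have "real N * \<bar>a\<bar> = \<bar>N * a\<bar>" "real N * \<bar>b\<bar> = \<bar>N * b\<bar>"
    by (auto simp: abs_mult)
  then have "-L \<le> \<lfloor>N * a\<rfloor>" "\<lfloor>N * b\<rfloor> \<le> L"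
    using L by linarith+
  then have sub: "{\<lfloor>N * a\<rfloor><..\<lfloor>N * b\<rfloor>} \<subseteq> {-L..L}"
    by auto
  have le: "\<lfloor>N * a\<rfloor> \<le> \<lfloor>N * b\<rfloor>"
    using ab by (intro floor_mono mult_left_mono) auto
  have "(\<Sum>i\<in>{-L..L}. (g (real_of_int (i + 1) / N) - g (i / N)) * indicator {a<..b} (i / N)) =
    (\<Sum>i\<in>{\<lfloor>N * a\<rfloor><..\<lfloor>N * b\<rfloor>}. g (real_of_int (i + 1) / N) - g (real_of_int i / N))"
    using sub by (intro sum.mono_neutral_cong_right) (auto simp: indicator_def iff simp del: greaterThanAtMost_iff)
  also have "\<dots> = g (real_of_int (\<lfloor>N * b\<rfloor> + 1) / N) - g (real_of_int (\<lfloor>N * a\<rfloor> + 1) / N)"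
    using le by (rule tele)
  finally show ?thesis by simp
qed

text \<open>Serves to compare a family of rectangles, indexed by \<open>Some\<close>, with one
  further rectangle at \<open>None\<close> that enters with the opposite sign.\<close>

lemma sum_insert_None:
  fixes h :: "'k option \<Rightarrow> 'a::comm_monoid_add"
  assumes "finite K"
  shows "(\<Sum>k\<in>insert None (Some ` K). h k) = h None + (\<Sum>k\<in>K. h (Some k))"
  using assms by (simp add: sum.reindex)

text \<open>\<open>F\<close> lives on the whole plane so that rectangles need no side conditions;
  copulas enter after clamping their arguments. The Lipschitz condition does the work of right
  continuity, with explicit error terms.\<close>

locale lipschitz_2_increasing =
  fixes F :: "real \<Rightarrow> real \<Rightarrow> real"
  assumes incr: "a \<le> b \<Longrightarrow> c \<le> d \<Longrightarrow> 0 \<le> rect F a b c d"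
    and lip: "\<bar>F u v - F u' v'\<bar> \<le> \<bar>u - u'\<bar> + \<bar>v - v'\<bar>"
begin

text \<open>The indicator of a rectangle factors, so the double sum telescopes in \<open>j\<close>
  and, after regrouping, in \<open>i\<close>. Since all ends are rounded by the same
  \<open>q\<close>, an inequality between indicators at grid points becomes one between rounded
  rectangles.\<close>

lemma rect_grid:
  fixes a b c d :: real and N :: nat and L :: int
  defines "p \<equiv> \<lambda>i::int. i / real N" and "q \<equiv> \<lambda>x::real. (\<lfloor>N * x\<rfloor> + 1) / real N"
  assumes N: "N > 0" and ab: "a \<le> b" "c \<le> d"
    and L: "real N * (\<bar>a\<bar> + \<bar>b\<bar> + \<bar>c\<bar> + \<bar>d\<bar>) + 1 \<le> L"
  shows "(\<Sum>i\<in>{-L..L}. \<Sum>j\<in>{-L..L}. rect F (p i) (p (i+1)) (p j) (p (j+1)) *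
           indicator ({a<..b} \<times> {c<..d}) (p i, p j)) = rect F (q a) (q b) (q c) (q d)"
proof -
  have bnd: "real N * \<bar>x\<bar> + 1 \<le> L" if "x \<in> {a, b, c, d}" for x
  proof -
    have "real N * \<bar>x\<bar> \<le> real N * (\<bar>a\<bar> + \<bar>b\<bar> + \<bar>c\<bar> + \<bar>d\<bar>)"
      using that by (intro mult_left_mono) auto
    then show ?thesis using L by simp
  qed
  have "(\<Sum>i\<in>{-L..L}. \<Sum>j\<in>{-L..L}. rect F (p i) (p (i+1)) (p j) (p (j+1)) *
           indicator ({a<..b} \<times> {c<..d}) (p i, p j)) =
    (\<Sum>i\<in>{-L..L}. (\<Sum>j\<in>{-L..L}. ((F (p (i+1)) (p (j+1)) - F (p i) (p (j+1))) -
      (F (p (i+1)) (p j) - F (p i) (p j))) * indicator {c<..d} (p j)) * indicator {a<..b} (p i))"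
    unfolding sum_distrib_right by (intro sum.cong refl) (auto simp: rect_def indicator_def)
  also have "\<dots> = (\<Sum>i\<in>{-L..L}. ((F (p (i+1)) (q d) - F (p i) (q d)) -
      (F (p (i+1)) (q c) - F (p i) (q c))) * indicator {a<..b} (p i))"
    unfolding p_def q_def
    by (subst grid_telescope[OF N ab(2) bnd bnd]) auto
  also have "\<dots> = (\<Sum>i\<in>{-L..L}. ((F (p (i+1)) (q d) - F (p (i+1)) (q c)) -
      (F (p i) (q d) - F (p i) (q c))) * indicator {a<..b} (p i))"
    by (simp add: algebra_simps)
  also have "\<dots> = rect F (q a) (q b) (q c) (q d)"
    unfolding p_def q_def rect_def
    by (subst grid_telescope[OF N ab(1) bnd bnd]) auto
  finally show ?thesis .
qed

text \<open>
  For the discrete measures that put the mass of each cell of a grid on its lower left corner the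
  inequality is trivial; it survives the limit of vanishing mesh because \<open>F\<close> is continuous.
  Finite additivity, monotonicity and finite subadditivity of \<open>rect F\<close> are special cases.
\<close>

lemma rect_sum_nonneg:
  fixes a b c d w :: "'k \<Rightarrow> real"
  assumes K: "finite K" and ab: "\<And>k. k \<in> K \<Longrightarrow> a k \<le> b k" "\<And>k. k \<in> K \<Longrightarrow> c k \<le> d k"
    and w: "\<And>z. 0 \<le> (\<Sum>k\<in>K. w k * indicator ({a k<..b k} \<times> {c k<..d k}) z)"
  shows "0 \<le> (\<Sum>k\<in>K. w k * rect F (a k) (b k) (c k) (d k))"
proof -
  define q where "q N x = (\<lfloor>real N * x\<rfloor> + 1) / real N" for N :: nat and x :: real
  have q: "(\<lambda>N. q N x) \<longlonglongrightarrow> x" for x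
    unfolding q_def by real_asymp
  have F: "(\<lambda>N. F (q N x) (q N y)) \<longlonglongrightarrow> F x y" for x y
  proof (rule Lim_null[THEN iffD2], rule Lim_null_comparison)
    have "(\<lambda>N. \<bar>q N x - x\<bar> + \<bar>q N y - y\<bar>) \<longlonglongrightarrow> \<bar>x - x\<bar> + \<bar>y - y\<bar>"
      by (intro tendsto_intros q)
    then show "(\<lambda>N. \<bar>q N x - x\<bar> + \<bar>q N y - y\<bar>) \<longlonglongrightarrow> 0"
      by simp
  qed (use lip in auto)
  have "(\<lambda>N. \<Sum>k\<in>K. w k * rect F (q N (a k)) (q N (b k)) (q N (c k)) (q N (d k)))
     \<longlonglongrightarrow> (\<Sum>k\<in>K. w k * rect F (a k) (b k) (c k) (d k))"
    unfolding rect_def by (intro tendsto_intros F)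
  moreover have "0 \<le> (\<Sum>k\<in>K. w k * rect F (q N (a k)) (q N (b k)) (q N (c k)) (q N (d k)))"
    if "N \<ge> 1" for N
  proof -
    have N: "N > 0" using that by simp
    define p where "p i = real_of_int i / real N" for i
    obtain L :: int where L: "real N * (\<Sum>k\<in>K. \<bar>a k\<bar> + \<bar>b k\<bar> + \<bar>c k\<bar> + \<bar>d k\<bar>) + 1 \<le> L"
      by (meson ex_le_of_int)
    have Lk: "real N * (\<bar>a k\<bar> + \<bar>b k\<bar> + \<bar>c k\<bar> + \<bar>d k\<bar>) + 1 \<le> L" if "k \<in> K" for k
    proof -
      have "real N * (\<bar>a k\<bar> + \<bar>b k\<bar> + \<bar>c k\<bar> + \<bar>d k\<bar>) \<le> real N * (\<Sum>k\<in>K. \<bar>a k\<bar> + \<bar>b k\<bar> + \<bar>c k\<bar> + \<bar>d k\<bar>)"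
        using K that by (intro mult_left_mono member_le_sum) auto
      then show ?thesis using L by simp
    qed
    have "(\<Sum>k\<in>K. w k * rect F (q N (a k)) (q N (b k)) (q N (c k)) (q N (d k))) =
      (\<Sum>k\<in>K. \<Sum>i\<in>{-L..L}. \<Sum>j\<in>{-L..L}. rect F (p i) (p (i+1)) (p j) (p (j+1)) *
         (w k * indicator ({a k<..b k} \<times> {c k<..d k}) (p i, p j)))"
    proof (rule sum.cong[OF refl])
      fix k assume k: "k \<in> K"
      show "w k * rect F (q N (a k)) (q N (b k)) (q N (c k)) (q N (d k)) =
        (\<Sum>i\<in>{-L..L}. \<Sum>j\<in>{-L..L}. rect F (p i) (p (i+1)) (p j) (p (j+1)) *
          (w k * indicator ({a k<..b k} \<times> {c k<..d k}) (p i, p j)))"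
        unfolding q_def p_def rect_grid[OF N ab(1)[OF k] ab(2)[OF k] Lk[OF k], symmetric] sum_distrib_left
        by (intro sum.cong refl) (rule mult.left_commute)
    qed
    \<comment> \<open>After the exchange each cell contributes its nonnegative mass times the
      weighted indicator sum at a single point, where \<open>w\<close> applies.\<close>
    also have "\<dots> = (\<Sum>i\<in>{-L..L}. \<Sum>j\<in>{-L..L}. rect F (p i) (p (i+1)) (p j) (p (j+1)) *
         (\<Sum>k\<in>K. w k * indicator ({a k<..b k} \<times> {c k<..d k}) (p i, p j)))"
      unfolding sum_distrib_left
      by (subst sum.swap, rule sum.cong[OF refl], rule sum.swap)
    also have "\<dots> \<ge> 0"
      by (intro sum_nonneg mult_nonneg_nonneg w incr) (auto simp: p_def divide_right_mono)
    finally show ?thesis .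
  qed
  ultimately show ?thesis
    by (intro LIMSEQ_le_const) auto
qed

lemma rect_le_sum:
  fixes l r s t :: "'k \<Rightarrow> real"
  assumes "finite K" "\<And>k. k \<in> K \<Longrightarrow> l k \<le> r k" "\<And>k. k \<in> K \<Longrightarrow> s k \<le> t k" "a \<le> b" "c \<le> d"
    and "{a<..b} \<times> {c<..d} \<subseteq> (\<Union>k\<in>K. {l k<..r k} \<times> {s k<..t k})"
  shows "rect F a b c d \<le> (\<Sum>k\<in>K. rect F (l k) (r k) (s k) (t k))"
proof -
  \<comment> \<open>The covered rectangle sits at \<open>None\<close> with weight -1. The condition
    of \<open>rect_sum_nonneg\<close> then says that the indicators of the cover add up to at least
    1 on it.\<close>
  define w :: "'k option \<Rightarrow> real" where "w = case_option (-1) (\<lambda>_. 1)"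
  have "0 \<le> (\<Sum>k\<in>insert None (Some ` K). w k * rect F (case_option a l k) (case_option b r k)
      (case_option c s k) (case_option d t k))"
  proof (rule rect_sum_nonneg)
    fix z
    have "indicator ({a<..b} \<times> {c<..d}) z \<le> (\<Sum>k\<in>K. indicator ({l k<..r k} \<times> {s k<..t k}) z :: real)"
    proof (cases "z \<in> {a<..b} \<times> {c<..d}")
      case True
      then obtain k where "k \<in> K" "z \<in> {l k<..r k} \<times> {s k<..t k}"
        using assms(6) by blast
      then have "1 = (indicator ({l k<..r k} \<times> {s k<..t k}) z :: real)"
        by simp
      also have "\<dots> \<le> (\<Sum>k\<in>K. indicator ({l k<..r k} \<times> {s k<..t k}) z)"
        using \<open>k \<in> K\<close> assms(1) by (intro member_le_sum) auto
      finally show ?thesis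
        using True by simp
    qed (simp add: sum_nonneg)
    then show "0 \<le> (\<Sum>k\<in>insert None (Some ` K). w k * indicator
      ({case_option a l k<..case_option b r k} \<times> {case_option c s k<..case_option d t k}) z)"
      unfolding sum_insert_None[OF assms(1)] w_def by (simp add: sum_negf)
  qed (use assms in auto)
  then show ?thesis
    unfolding sum_insert_None[OF assms(1)] w_def by (simp add: sum_negf)
qed

lemma sum_rect_le:
  fixes l r s t :: "'k \<Rightarrow> real"
  assumes "finite K" "\<And>k. k \<in> K \<Longrightarrow> l k \<le> r k" "\<And>k. k \<in> K \<Longrightarrow> s k \<le> t k" "a \<le> b" "c \<le> d"
    and disj: "disjoint_family_on (\<lambda>k. {l k<..r k} \<times> {s k<..t k}) K"
    and sub: "\<And>k. k \<in> K \<Longrightarrow> {l k<..r k} \<times> {s k<..t k} \<subseteq> {a<..b} \<times> {c<..d}"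
  shows "(\<Sum>k\<in>K. rect F (l k) (r k) (s k) (t k)) \<le> rect F a b c d"
proof -
  define w :: "'k option \<Rightarrow> real" where "w = case_option 1 (\<lambda>_. -1)"
  have "0 \<le> (\<Sum>k\<in>insert None (Some ` K). w k * rect F (case_option a l k) (case_option b r k)
      (case_option c s k) (case_option d t k))"
  proof (rule rect_sum_nonneg)
    fix z
    have "(\<Sum>k\<in>K. indicator ({l k<..r k} \<times> {s k<..t k}) z :: real) =
        indicator (\<Union>k\<in>K. {l k<..r k} \<times> {s k<..t k}) z"
      using assms(1) disj by (rule indicator_UN_disjoint[symmetric])
    also have "\<dots> \<le> indicator ({a<..b} \<times> {c<..d}) z"
      using sub by (intro indicator_leI) blast
    finally show "0 \<le> (\<Sum>k\<in>insert None (Some ` K). w k * indicator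
      ({case_option a l k<..case_option b r k} \<times> {case_option c s k<..case_option d t k}) z)"
      unfolding sum_insert_None[OF assms(1)] w_def by (simp add: sum_negf)
  qed (use assms in auto)
  then show ?thesis
    unfolding sum_insert_None[OF assms(1)] w_def by (simp add: sum_negf)
qed

lemma rect_mono_set:
  assumes "a \<le> b" "c \<le> d" "a' \<le> b'" "c' \<le> d'" "{a<..b} \<times> {c<..d} \<subseteq> {a'<..b'} \<times> {c'<..d'}"
  shows "rect F a b c d \<le> rect F a' b' c' d'"
  using rect_le_sum[of "{()}" "\<lambda>_. a'" "\<lambda>_. b'" "\<lambda>_. c'" "\<lambda>_. d'" a b c d] assms by simp

text \<open>Partial sums stay below the total by finite additivity. For the converse, a slightly
  smaller closed rectangle is compact, slightly larger tiles are open, and finite subadditivity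
  applies to a finite subcover.\<close>

lemma rect_suminf:
  fixes l r s t :: "nat \<Rightarrow> real"
  assumes lr: "\<And>n. l n \<le> r n" "\<And>n. s n \<le> t n" and ab: "a \<le> b" "c \<le> d"
    and disj: "disjoint_family (\<lambda>n. {l n<..r n} \<times> {s n<..t n})"
    and UN: "(\<Union>n. {l n<..r n} \<times> {s n<..t n}) = {a<..b} \<times> {c<..d}"
  shows "(\<Sum>n. ennreal (rect F (l n) (r n) (s n) (t n))) = ennreal (rect F a b c d)"
proof -
  define V where "V n = rect F (l n) (r n) (s n) (t n)" for n
  have V0: "0 \<le> V n" for n
    unfolding V_def by (intro incr lr)
  have le: "sum V K \<le> rect F a b c d" if "finite K" for K
    unfolding V_def
  proof (intro sum_rect_le that lr ab)
    show "disjoint_family_on (\<lambda>n. {l n<..r n} \<times> {s n<..t n}) K"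
      using disj by (rule disjoint_family_on_mono[rotated]) simp
    show "{l n<..r n} \<times> {s n<..t n} \<subseteq> {a<..b} \<times> {c<..d}" for n
      unfolding UN[symmetric] by blast
  qed
  have sm: "summable V"
    using le by (intro summableI_nonneg_bounded[of _ "rect F a b c d"] V0) auto
  have "rect F a b c d \<le> suminf V"
  proof (rule field_le_epsilon)
    fix e :: real assume e: "e > 0"
    \<comment> \<open>The error \<open>e\<close> is halved: shrinking the rectangle costs at most 4
      \<eta> = e/2, and enlarging all tiles costs at most four times the sum of \<delta>, again
      e/2.\<close>
    define \<eta> where "\<eta> = e / 8"
    define \<delta> where "\<delta> n = e / 16 * (1 / 2) ^ n" for n :: nat
    have \<eta>: "\<eta> > 0" and \<delta>: "\<delta> n > 0" for n
      using e by (auto simp: \<eta>_def \<delta>_def)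
    show "rect F a b c d \<le> suminf V + e"
    proof (cases "a + \<eta> \<le> b \<and> c + \<eta> \<le> d")
      \<comment> \<open>A rectangle too thin to be shrunk by \<eta> has mass below 2 \<eta>, by the
        Lipschitz bound across its short side.\<close>
      case False
      have "rect F a b c d \<le> 2 * (b - a)"
        using lip[of b d a d] lip[of b c a c] ab unfolding rect_def by simp
      moreover have "rect F a b c d \<le> 2 * (d - c)"
        using lip[of b d b c] lip[of a d a c] ab unfolding rect_def by simp
      moreover have "b - a < \<eta> \<or> d - c < \<eta>"
        using False by linarith
      ultimately have "rect F a b c d \<le> e"
        using e unfolding \<eta>_def by (elim disjE) simp_all
      moreover have "0 \<le> suminf V"
        using sm V0 by (rule suminf_nonneg)
      ultimately show ?thesis by simp
    next
      case True
      define O' where "O' n = {l n<..<r n + \<delta> n} \<times> {s n<..<t n + \<delta> n}" for n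
      have "{l n<..r n} \<times> {s n<..t n} \<subseteq> O' n" for n
        using \<delta>[of n] unfolding O'_def by auto
      then have "{a<..b} \<times> {c<..d} \<subseteq> (\<Union>n. O' n)"
        unfolding UN[symmetric] by blast
      moreover have "{a + \<eta>..b} \<times> {c + \<eta>..d} \<subseteq> {a<..b} \<times> {c<..d}"
        using \<eta> by auto
      ultimately have "{a + \<eta>..b} \<times> {c + \<eta>..d} \<subseteq> (\<Union>n\<in>UNIV. O' n)"
        by blast
      moreover have "compact ({a + \<eta>..b} \<times> {c + \<eta>..d})"
        by (intro compact_Times compact_Icc)
      moreover have "open (O' n)" for n
        unfolding O'_def by (intro open_Times open_greaterThanLessThan)
      ultimately obtain K where K: "finite K" "{a + \<eta>..b} \<times> {c + \<eta>..d} \<subseteq> (\<Union>n\<in>K. O' n)"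
        by (elim compactE_image) auto
      have "{a + \<eta><..b} \<times> {c + \<eta><..d} \<subseteq> {a + \<eta>..b} \<times> {c + \<eta>..d}"
        by auto
      also have "\<dots> \<subseteq> (\<Union>n\<in>K. O' n)"
        by (rule K)
      also have "\<dots> \<subseteq> (\<Union>n\<in>K. {l n<..r n + \<delta> n} \<times> {s n<..t n + \<delta> n})"
        unfolding O'_def by (intro UN_mono) auto
      finally have "rect F (a + \<eta>) b (c + \<eta>) d \<le>
          (\<Sum>n\<in>K. rect F (l n) (r n + \<delta> n) (s n) (t n + \<delta> n))"
      proof (intro rect_le_sum K(1))
        show "l n \<le> r n + \<delta> n" "s n \<le> t n + \<delta> n" for n
          using lr(1)[of n] lr(2)[of n] \<delta>[of n] by simp_all
      qed (use True in auto)
      also have "\<dots> \<le> (\<Sum>n\<in>K. V n + 4 * \<delta> n)"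
      proof (rule sum_mono)
        fix n
        show "rect F (l n) (r n + \<delta> n) (s n) (t n + \<delta> n) \<le> V n + 4 * \<delta> n"
          using lip[of "r n + \<delta> n" "t n + \<delta> n" "r n" "t n"] lip[of "r n + \<delta> n" "s n" "r n" "s n"]
            lip[of "l n" "t n + \<delta> n" "l n" "t n"] \<delta>[of n]
          unfolding V_def rect_def by simp
      qed
      also have "\<dots> = sum V K + 4 * sum \<delta> K"
        by (simp add: sum.distrib sum_distrib_left)
      also have "sum V K \<le> suminf V"
        using sm K(1) V0 by (intro sum_le_suminf) auto
      also have "sum \<delta> K \<le> suminf \<delta>"
        using K(1) \<delta> unfolding \<delta>_def
        by (intro sum_le_suminf summable_mult summable_geometric) (auto intro: less_imp_le)
      also have "suminf \<delta> = e / 8"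
        unfolding \<delta>_def by (subst suminf_mult) (auto simp: suminf_geometric)
      finally have "rect F (a + \<eta>) b (c + \<eta>) d \<le> suminf V + e / 2"
        by simp
      moreover have "rect F a b c d \<le> rect F (a + \<eta>) b (c + \<eta>) d + 4 * \<eta>"
        using lip[of a d "a + \<eta>" d] lip[of a c "a + \<eta>" "c + \<eta>"] lip[of b c b "c + \<eta>"] \<eta>
        unfolding rect_def by simp
      ultimately show ?thesis
        by (simp add: \<eta>_def)
    qed
  qed
  moreover have "suminf V \<le> rect F a b c d"
    using sm le by (intro suminf_le_const) auto
  ultimately have "suminf V = rect F a b c d"
    by simp
  then show ?thesis
    using suminf_ennreal2[OF V0 sm] unfolding V_def by simp
qed

lemma ex_measure:
  "\<exists>M. sets M = sets borel \<and>
     (\<forall>a b c d. a \<le> b \<longrightarrow> c \<le> d \<longrightarrow> emeasure M ({a<..b} \<times> {c<..d}) = ennreal (rect F a b c d))"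
proof -
  define I :: "((real \<times> real) \<times> (real \<times> real)) set"
    where "I = {((a, b), (c, d)) | a b c d. a \<le> b \<and> c \<le> d}"
  define G where "G = (\<lambda>((a, b), (c, d)). {a<..b} \<times> {c<..d :: real} :: (real \<times> real) set)"
  define \<mu> where "\<mu> = (\<lambda>((a, b), (c, d)). ennreal (rect F a b c d))"
  define M where "M = extend_measure UNIV I G \<mu>"
  have G_I: "G ` I = {A \<times> B | A B. A \<in> {{a<..b} |a b :: real. a \<le> b} \<and> B \<in> {{a<..b} |a b :: real. a \<le> b}}"
    unfolding G_def I_def by (auto simp: image_def)
  \<comment> \<open>Distinct indices may describe the same set, as all degenerate rectangles do.
    Monotonicity in the set makes the mass independent of the index and zero on the empty
    set.\<close>
  have mono: "\<mu> i \<le> \<mu> j" if "i \<in> I" "j \<in> I" "G i \<subseteq> G j" for i j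
    using that unfolding I_def G_def \<mu>_def by (auto intro!: ennreal_leI rect_mono_set)
  have em: "emeasure M (G i) = \<mu> i" if "i \<in> I" for i
  proof (rule extend_measure_caratheodory[OF M_def that])
    show "semiring_of_sets UNIV (G ` I)"
      using semiring_of_sets_Times[OF semiring_of_sets_Ioc semiring_of_sets_Ioc]
      unfolding G_I by simp
    show "\<mu> i = 0" if "i \<in> I" "G i = {}" for i
    proof -
      have "\<mu> ((0, 0), (0, 0)) = 0"
        by (simp add: \<mu>_def rect_def)
      moreover have "\<mu> i \<le> \<mu> ((0, 0), (0, 0))"
        using that by (intro mono) (auto simp: I_def)
      ultimately show ?thesis by simp
    qed
    show "\<mu> i = \<mu> j" if "i \<in> I" "j \<in> I" "G i = G j" for i j
      using that mono[of i j] mono[of j i] by simp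
    show "0 \<le> \<mu> i" for i
      by simp
    fix A :: "nat \<Rightarrow> (real \<times> real) \<times> (real \<times> real)" and j
    assume A: "A \<in> UNIV \<rightarrow> I" and j: "j \<in> I" and disj: "disjoint_family (G \<circ> A)"
      and UN: "(\<Union>n. G (A n)) = G j"
    obtain a b c d where jj: "j = ((a, b), (c, d))"
      by (metis surj_pair)
    obtain l r s t where A_eq: "A n = ((l n, r n), (s n, t n))" for n
      by (rule that[of "fst \<circ> fst \<circ> A" "snd \<circ> fst \<circ> A" "fst \<circ> snd \<circ> A" "snd \<circ> snd \<circ> A"]) simp
    have "A n \<in> I" for n
      using A by auto
    then have "(\<Sum>n. ennreal (rect F (l n) (r n) (s n) (t n))) = ennreal (rect F a b c d)"
      using j disj UN unfolding A_eq jj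
      by (intro rect_suminf) (auto simp: I_def G_def comp_def A_eq)
    then show "(\<Sum>n. \<mu> (A n)) = \<mu> j"
      by (simp add: \<mu>_def A_eq jj)
  qed
  have "sets M = sigma_sets UNIV (G ` I)"
    unfolding M_def by (subst sets_extend_measure) auto
  also have "\<dots> = sigma_sets UNIV (range atMost)"
  proof (rule sigma_sets_eqI)
    fix X assume "X \<in> G ` I"
    then have "X \<in> sets borel"
      unfolding G_I by (auto simp: borel_prod[symmetric])
    also have "sets borel = sigma_sets UNIV (range atMost :: (real \<times> real) set set)"
      by (subst borel_eq_atMost) simp
    finally show "X \<in> sigma_sets UNIV (range atMost)" .
  next
    fix X :: "(real \<times> real) set" assume "X \<in> range atMost"
    then obtain u v where X: "X = {..(u, v)}"
      by auto
    \<comment> \<open>A quadrant is a countable union of half-open rectangles; \<open>min\<close>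
      keeps their endpoints ordered for every \<open>n\<close>, also when \<open>u\<close> or
      \<open>v\<close> is very negative.\<close>
    have "(x, y) \<in> (\<Union>n::nat. {min u (- real n)<..u} \<times> {min v (- real n)<..v})"
      if "x \<le> u" "y \<le> v" for x y
    proof -
      obtain n :: nat where "max (- x) (- y) < n"
        using reals_Archimedean2 by blast
      then show ?thesis
        using that by (intro UN_I[of n]) auto
    qed
    then have "X = (\<Union>n::nat. {min u (- real n)<..u} \<times> {min v (- real n)<..v})"
      unfolding X by (auto simp: less_eq_prod_def)
    moreover have "{min u (- real n)<..u} \<times> {min v (- real n)<..v} \<in> G ` I" for n
      unfolding G_def I_def
      by (intro image_eqI[of _ _ "((min u (- real n), u), (min v (- real n), v))"]) auto
    ultimately show "X \<in> sigma_sets UNIV (G ` I)"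
      by (simp only:) (intro sigma_sets.Union sigma_sets.Basic)
  qed
  also have "\<dots> = sets borel"
    by (subst borel_eq_atMost) simp
  finally show ?thesis
    using em unfolding I_def G_def \<mu>_def by (intro exI[of _ M]) fastforce
qed

end

section \<open>The measure of a copula\<close>

lemma copula_bdry:
  assumes "copula C" "0 \<le> t" "t \<le> 1"
  shows "C t 0 = 0" "C 0 t = 0" "C t 1 = t" "C 1 t = t"
  using assms unfolding copula_def by auto

lemma copula_rect_nonneg:
  assumes "copula C" "0 \<le> a" "a \<le> b" "b \<le> 1" "0 \<le> c" "c \<le> d" "d \<le> 1"
  shows "0 \<le> rect C a b c d"
  using assms unfolding copula_def rect_def by blast

text \<open>The strip between u and u' has total mass u' - u, and its part below height v has mass C
  u' v - C u v. Both this part and the part above v have nonnegative mass.\<close>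

lemma copula_increment:
  assumes C: "copula C" and u: "0 \<le> u" "u \<le> u'" "u' \<le> 1" and v: "0 \<le> v" "v \<le> 1"
  shows "0 \<le> C u' v - C u v" "C u' v - C u v \<le> u' - u"
    and "0 \<le> C v u' - C v u" "C v u' - C v u \<le> u' - u"
  using copula_rect_nonneg[OF C u, of 0 v] copula_rect_nonneg[OF C u, of v 1]
    copula_rect_nonneg[OF C _ _ _ u, of 0 v] copula_rect_nonneg[OF C _ _ _ u, of v 1]
    copula_bdry[OF C, of u] copula_bdry[OF C, of u'] copula_bdry[OF C, of v] u v
  unfolding rect_def by auto

text \<open>Together with nonnegativity these are the Frechet-Hoeffding bounds; they follow from the
  increments between an argument and the ends 0 and 1.\<close>

lemma copula_bounds:
  assumes C: "copula C" and u: "0 \<le> u" "u \<le> 1" and v: "0 \<le> v" "v \<le> 1"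
  shows "0 \<le> C u v" "C u v \<le> u" "C u v \<le> v" "u + v - 1 \<le> C u v"
  using copula_increment[OF C order_refl u v] copula_increment[OF C u order_refl v]
    copula_increment[OF C order_refl v u] copula_increment[OF C v order_refl u]
    copula_bdry[OF C u] copula_bdry[OF C v]
  by auto

lemma copula_lipschitz:
  assumes C: "copula C" and "u \<in> {0..1}" "v \<in> {0..1}" "u' \<in> {0..1}" "v' \<in> {0..1}"
  shows "\<bar>C u v - C u' v'\<bar> \<le> \<bar>u - u'\<bar> + \<bar>v - v'\<bar>"
proof -
  have "\<bar>C u v - C u' v\<bar> \<le> \<bar>u - u'\<bar>"
    using assms copula_increment(1,2)[OF C, of u u' v] copula_increment(1,2)[OF C, of u' u v]
    by (cases "u \<le> u'") auto
  moreover have "\<bar>C u' v - C u' v'\<bar> \<le> \<bar>v - v'\<bar>"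
    using assms copula_increment(3,4)[OF C, of v v' u'] copula_increment(3,4)[OF C, of v' v u']
    by (cases "v \<le> v'") auto
  ultimately show ?thesis by linarith
qed

text \<open>A copula is arbitrary outside the square. Clamping both arguments gives a 2-increasing
  Lipschitz function on the plane, suited both to the construction of the measure and as a Borel
  integrand.\<close>

definition clamp01 :: "real \<Rightarrow> real" where
  "clamp01 x = max 0 (min 1 x)"

lemma clamp01_simps [simp]:
  "0 \<le> clamp01 x" "clamp01 x \<le> 1" "clamp01 x \<in> {0..1}"
  "x \<le> 0 \<Longrightarrow> clamp01 x = 0" "1 \<le> x \<Longrightarrow> clamp01 x = 1" "0 \<le> x \<Longrightarrow> x \<le> 1 \<Longrightarrow> clamp01 x = x"
  by (auto simp: clamp01_def)

lemma clamp01_mono: "x \<le> y \<Longrightarrow> clamp01 x \<le> clamp01 y"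
  by (auto simp: clamp01_def)

lemma clamp01_lipschitz: "\<bar>clamp01 x - clamp01 y\<bar> \<le> \<bar>x - y\<bar>"
  by (auto simp: clamp01_def)

lemma continuous_clamp01: "continuous_on A clamp01"
  unfolding clamp01_def by (intro continuous_intros)

lemma lipschitz_2_increasing_copula:
  assumes C: "copula C"
  shows "lipschitz_2_increasing (\<lambda>u v. C (clamp01 u) (clamp01 v))"
proof
  fix a b c d :: real assume "a \<le> b" "c \<le> d"
  then show "0 \<le> rect (\<lambda>u v. C (clamp01 u) (clamp01 v)) a b c d"
    using copula_rect_nonneg[OF C, of "clamp01 a" "clamp01 b" "clamp01 c" "clamp01 d"]
    by (simp add: rect_def clamp01_mono)
next
  fix u v u' v'
  show "\<bar>C (clamp01 u) (clamp01 v) - C (clamp01 u') (clamp01 v')\<bar> \<le> \<bar>u - u'\<bar> + \<bar>v - v'\<bar>"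
    using copula_lipschitz[OF C, of "clamp01 u" "clamp01 v" "clamp01 u'" "clamp01 v'"]
      clamp01_lipschitz[of u u'] clamp01_lipschitz[of v v'] by simp
qed

text \<open>The predicate under the description operator of \<open>copula_measure\<close>, isolated
  to speak about existence and uniqueness.\<close>

definition has_copula :: "(real \<times> real) measure \<Rightarrow> (real \<Rightarrow> real \<Rightarrow> real) \<Rightarrow> bool" where
  "has_copula M C \<longleftrightarrow> sets M = sets borel \<and> emeasure M (- unit_square) = 0 \<and>
     (\<forall>u\<in>{0..1}. \<forall>v\<in>{0..1}. emeasure M ({0..u} \<times> {0..v}) = ennreal (C u v))"

lemma unit_square_borel [measurable]: "unit_square \<in> sets borel"
  unfolding unit_square_def by (simp add: borel_prod[symmetric])

text \<open>The masses of half-open rectangles are recorded as well, because uniqueness later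
  transfers them to every measure with \<open>has_copula\<close>.\<close>

lemma ex_has_copula:
  assumes C: "copula C"
  shows "\<exists>M. has_copula M C \<and> (\<forall>a b c d. a \<le> b \<longrightarrow> c \<le> d \<longrightarrow> emeasure M ({a<..b} \<times> {c<..d}) =
    ennreal (rect (\<lambda>u v. C (clamp01 u) (clamp01 v)) a b c d))"
proof -
  let ?F = "\<lambda>u v. C (clamp01 u) (clamp01 v)"
  interpret F: lipschitz_2_increasing ?F
    using C by (rule lipschitz_2_increasing_copula)
  obtain M where sets[measurable_cong]: "sets M = sets borel"
    and em: "a \<le> b \<Longrightarrow> c \<le> d \<Longrightarrow> emeasure M ({a<..b} \<times> {c<..d}) = ennreal (rect ?F a b c d)"
    for a b c d
    using F.ex_measure by auto
  have space: "space M = UNIV"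
    using sets_eq_imp_space_eq[OF sets] by simp
  have box_sets: "A \<in> sets borel \<Longrightarrow> B \<in> sets borel \<Longrightarrow> A \<times> B \<in> sets M" for A B :: "real set"
    unfolding sets by (simp add: borel_prod[symmetric])
  have bdry: "C t 0 = 0" "C 0 t = 0" "C t 1 = t" "C 1 t = t" if "t \<in> {0..1}" for t
    using copula_bdry[OF C] that by auto
  \<comment> \<open>With \<open>Suc n\<close> every box contains the unit square: its corners clamp
    to 0 and 1, and its mass is 1 from the start.\<close>
  have "incseq (\<lambda>n. {- real (Suc n)<..real (Suc n)} \<times> {- real (Suc n)<..real (Suc n)})"
    by (intro incseq_SucI Sigma_mono) auto
  then have "(\<lambda>n. emeasure M ({- real (Suc n)<..real (Suc n)} \<times> {- real (Suc n)<..real (Suc n)})) \<longlonglongrightarrow>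
      emeasure M (\<Union>n. {- real (Suc n)<..real (Suc n)} \<times> {- real (Suc n)<..real (Suc n)})"
    by (intro Lim_emeasure_incseq) (auto intro!: box_sets simp del: of_nat_Suc)
  moreover have "(\<Union>n. {- real (Suc n)<..real (Suc n)} \<times> {- real (Suc n)<..real (Suc n)}) = space M"
  proof -
    have "z \<in> (\<Union>n. {- real (Suc n)<..real (Suc n)} \<times> {- real (Suc n)<..real (Suc n)})" for z :: "real \<times> real"
    proof -
      obtain n where "max \<bar>fst z\<bar> \<bar>snd z\<bar> < real n"
        using reals_Archimedean2 by blast
      then show ?thesis
        by (intro UN_I[of n]) (auto simp: mem_Times_iff)
    qed
    then show ?thesis
      unfolding space by (intro equalityI subset_UNIV subsetI)
  qed
  moreover have "emeasure M ({- real (Suc n)<..real (Suc n)} \<times> {- real (Suc n)<..real (Suc n)}) = 1" for n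
    using em[of "- real (Suc n)" "real (Suc n)" "- real (Suc n)" "real (Suc n)"] bdry[of 0] bdry[of 1]
    by (simp add: rect_def del: of_nat_Suc)
  ultimately have total: "emeasure M (space M) = 1"
    by (simp add: LIMSEQ_const_iff)
  then interpret prob_space M
    by (rule prob_spaceI)
  \<comment> \<open>All mass lies in (0, 1] x (0, 1], so the left and bottom edges are null and
    closed rectangles may replace half-open ones.\<close>
  have "emeasure M ({0<..1} \<times> {0<..1}) = 1"
    using em[of 0 1 0 1] bdry[of 0] bdry[of 1] by (simp add: rect_def)
  then have null: "emeasure M (space M - {0<..1} \<times> {0<..1}) = 0"
    by (subst emeasure_compl) (auto simp: total intro!: box_sets)
  have "has_copula M C"
    unfolding has_copula_def
  proof (intro conjI ballI sets)
    have "emeasure M (- unit_square) \<le> emeasure M (space M - {0<..1} \<times> {0<..1})"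
      by (intro emeasure_mono) (auto simp: unit_square_def space intro!: sets.Diff box_sets)
    then show "emeasure M (- unit_square) = 0"
      using null by simp
    fix u v :: real assume uv: "u \<in> {0..1}" "v \<in> {0..1}"
    have "emeasure M ({0..u} \<times> {0..v}) = emeasure M ({0<..u} \<times> {0<..v})"
    proof (rule emeasure_eq_AE)
      have "AE z in M. z \<in> {0<..1} \<times> {0<..1}"
        using null by (intro AE_I[where N="space M - {0<..1} \<times> {0<..1}"]) (auto intro!: sets.Diff box_sets)
      then show "AE z in M. (z \<in> {0..u} \<times> {0..v}) = (z \<in> {0<..u} \<times> {0<..v})"
        by eventually_elim auto
    qed (auto intro!: box_sets)
    also have "\<dots> = ennreal (C u v)"
      using uv em[of 0 u 0 v] bdry[of 0] bdry(1)[of u] bdry(2)[of v] by (simp add: rect_def)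
    finally show "emeasure M ({0..u} \<times> {0..v}) = ennreal (C u v)" .
  qed
  then show ?thesis
    using em by blast
qed

text \<open>Carries the defining masses over to quadrants, an intersection-stable generator of the
  Borel sets that exhausts the plane, as the uniqueness argument requires.\<close>

lemma has_copula_atMost:
  assumes M: "has_copula M C" and C: "copula C"
  shows "emeasure M {..(u, v)} = ennreal (C (clamp01 u) (clamp01 v))"
proof -
  have sets[measurable_cong]: "sets M = sets borel" and null: "emeasure M (- unit_square) = 0"
    and rect: "\<And>u v. u \<in> {0..1} \<Longrightarrow> v \<in> {0..1} \<Longrightarrow> emeasure M ({0..u} \<times> {0..v}) = ennreal (C u v)"
    using M unfolding has_copula_def by auto
  have AE: "AE z in M. z \<in> unit_square"
    using null by (intro AE_I[where N="- unit_square"]) (auto simp: sets)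
  show ?thesis
  proof (cases "0 \<le> u \<and> 0 \<le> v")
    case True
    have "emeasure M {..(u, v)} = emeasure M ({0..clamp01 u} \<times> {0..clamp01 v})"
    proof (rule emeasure_eq_AE)
      show "AE z in M. (z \<in> {..(u, v)}) = (z \<in> {0..clamp01 u} \<times> {0..clamp01 v})"
        using AE by eventually_elim (use True in \<open>auto simp: unit_square_def clamp01_def less_eq_prod_def\<close>)
    qed (auto simp: sets borel_Times)
    then show ?thesis by (simp add: rect)
  next
    case False
    have "emeasure M {..(u, v)} = emeasure M {}"
      by (rule emeasure_eq_AE, use AE in eventually_elim)
         (use False in \<open>auto simp: unit_square_def less_eq_prod_def sets\<close>)
    moreover have "C (clamp01 u) (clamp01 v) = 0"
      using False copula_bdry[OF C, of "clamp01 u"] copula_bdry[OF C, of "clamp01 v"]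
      by (auto simp: not_le)
    ultimately show ?thesis by simp
  qed
qed

lemma has_copula_unique:
  assumes C: "copula C" and M: "has_copula M C" and N: "has_copula N C"
  shows "M = N"
proof (rule measure_eqI_generator_eq[where \<Omega>=UNIV and E="range atMost" and A="\<lambda>n. {..(real n, real n)}"])
  show "Int_stable (range atMost :: (real \<times> real) set set)"
  proof (rule Int_stableI)
    fix X Y :: "(real \<times> real) set" assume "X \<in> range atMost" "Y \<in> range atMost"
    then obtain a b where "X = {..a}" "Y = {..b}"
      by auto
    then have "X \<inter> Y = {..(min (fst a) (fst b), min (snd a) (snd b))}"
      by (auto simp: less_eq_prod_def)
    then show "X \<inter> Y \<in> range atMost"
      by blast
  qed
  show "sets M = sigma_sets UNIV (range atMost)" "sets N = sigma_sets UNIV (range atMost)"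
    using M N unfolding has_copula_def borel_eq_atMost by simp_all
  show "emeasure M X = emeasure N X" if "X \<in> range atMost" for X
    using that has_copula_atMost[OF M C] has_copula_atMost[OF N C] by auto
  show "(\<Union>n. {..(real n, real n)}) = UNIV"
  proof -
    have "z \<in> (\<Union>n. {..(real n, real n)})" for z :: "real \<times> real"
      using reals_Archimedean2[of "max (fst z) (snd z)"] by (auto simp: less_eq_prod_def intro: less_imp_le)
    then show ?thesis
      by (intro equalityI subset_UNIV subsetI)
  qed
  show "emeasure M {..(real n, real n)} \<noteq> \<infinity>" for n
    by (simp add: has_copula_atMost[OF M C])
qed auto

lemma has_copula_copula_measure:
  assumes C: "copula C"
  shows "has_copula (copula_measure C) C"
proof -
  have "\<exists>!M. has_copula M C"
    using ex_has_copula[OF C] has_copula_unique[OF C] by blast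
  then have "has_copula (THE M. has_copula M C) C"
    by (rule theI')
  then show ?thesis
    unfolding copula_measure_def has_copula_def .
qed

lemma copula_measure_eqI:
  "copula C \<Longrightarrow> has_copula M C \<Longrightarrow> copula_measure C = M"
  using has_copula_copula_measure has_copula_unique by blast

lemma emeasure_copula_rect:
  assumes C: "copula C" and "has_copula M C" and "0 \<le> a" "a \<le> b" "b \<le> 1" "0 \<le> c" "c \<le> d" "d \<le> 1"
  shows "emeasure M ({a<..b} \<times> {c<..d}) = ennreal (rect C a b c d)"
proof -
  obtain N where N: "has_copula N C" "emeasure N ({a<..b} \<times> {c<..d}) =
      ennreal (rect (\<lambda>u v. C (clamp01 u) (clamp01 v)) a b c d)"
    using ex_has_copula[OF C] assms by blast
  then show ?thesis
    using has_copula_unique[OF C assms(2) N(1)] assms by (simp add: rect_def)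
qed

section \<open>Integration against the measure of a copula\<close>

lemma has_copula_AE:
  assumes "has_copula M C"
  shows "AE z in M. z \<in> unit_square"
  using assms unfolding has_copula_def by (intro AE_I[where N="- unit_square"]) auto

lemma has_copula_prob_space:
  assumes C: "copula C" and M: "has_copula M C"
  shows "prob_space M"
proof (rule prob_spaceI)
  have sets: "sets M = sets borel"
    using M unfolding has_copula_def by simp
  have "emeasure M (space M) = emeasure M {..(1, 1)}"
    by (rule emeasure_eq_AE, use has_copula_AE[OF M] in eventually_elim)
       (auto simp: unit_square_def less_eq_prod_def sets sets_eq_imp_space_eq[OF sets])
  then show "emeasure M (space M) = 1"
    using has_copula_atMost[OF M C, of 1 1] copula_bdry[OF C, of 1] by simp
qed

lemma continuous_copula_clamp:
  assumes "copula C"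
  shows "continuous_on UNIV (\<lambda>z. C (clamp01 (fst z)) (clamp01 (snd z)))"
  unfolding continuous_on_iff
proof (intro ballI allI impI)
  interpret lipschitz_2_increasing "\<lambda>u v. C (clamp01 u) (clamp01 v)"
    using assms by (rule lipschitz_2_increasing_copula)
  fix z :: "real \<times> real" and e :: real assume e: "e > 0"
  have "dist (C (clamp01 (fst y)) (clamp01 (snd y))) (C (clamp01 (fst z)) (clamp01 (snd z))) < e"
    if "dist y z < e / 2" for y
  proof -
    have "dist (C (clamp01 (fst y)) (clamp01 (snd y))) (C (clamp01 (fst z)) (clamp01 (snd z)))
        \<le> dist (fst y) (fst z) + dist (snd y) (snd z)"
      using lip by (simp add: dist_real_def)
    also have "\<dots> \<le> dist y z + dist y z"
      by (intro add_mono dist_fst_le dist_snd_le)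
    finally show ?thesis using that by simp
  qed
  then show "\<exists>d>0. \<forall>y\<in>UNIV. dist y z < d \<longrightarrow>
      dist (C (clamp01 (fst y)) (clamp01 (snd y))) (C (clamp01 (fst z)) (clamp01 (snd z))) < e"
    using e by (intro exI[of _ "e / 2"]) auto
qed

lemma borel_measurable_copula_clamp:
  "copula C \<Longrightarrow> (\<lambda>z. C (clamp01 (fst z)) (clamp01 (snd z))) \<in> borel_measurable borel"
  by (rule borel_measurable_continuous_onI, rule continuous_copula_clamp)

lemma borel_measurable_clamp01 [measurable]: "clamp01 \<in> borel_measurable borel"
  by (rule borel_measurable_continuous_onI, rule continuous_clamp01)

lemma integrable_copula_clamp:
  assumes C: "copula C" and M: "has_copula M D" "copula D"
  shows "integrable M (\<lambda>z. C (clamp01 (fst z)) (clamp01 (snd z)))"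
proof -
  interpret prob_space M
    using M by (intro has_copula_prob_space)
  have "(\<lambda>z. C (clamp01 (fst z)) (clamp01 (snd z))) \<in> borel_measurable M"
    using borel_measurable_copula_clamp[OF C] M unfolding has_copula_def
    by (simp cong: measurable_cong_sets)
  moreover have "norm (C (clamp01 (fst z)) (clamp01 (snd z))) \<le> 1" for z
    using copula_bounds(1,2)[OF C, of "clamp01 (fst z)" "clamp01 (snd z)"]
      order_trans[OF _ clamp01_simps(2)[of "fst z"]] by simp
  ultimately show ?thesis
    by (intro integrable_const_bound[of _ 1]) auto
qed

section \<open>Bounds on Kendall's tau\<close>

text \<open>The square carries all mass and clamping is the identity there, so the set integral of
  \<open>C\<close> becomes an integral of a continuous function over the plane.\<close>

lemma kendall_tau_eq:
  assumes C: "copula C" and M: "has_copula M C"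
  shows "kendall_tau C = 4 * (\<integral>z. C (clamp01 (fst z)) (clamp01 (snd z)) \<partial>M) - 1"
proof -
  have sets: "sets M = sets borel"
    using M unfolding has_copula_def by simp
  have "(LINT (u, v):unit_square|M. C u v) =
      (\<integral>z. indicator unit_square z *\<^sub>R C (clamp01 (fst z)) (clamp01 (snd z)) \<partial>M)"
    unfolding set_lebesgue_integral_def
    by (intro Bochner_Integration.integral_cong refl) (auto simp: unit_square_def indicator_def)
  also have "\<dots> = (\<integral>z. C (clamp01 (fst z)) (clamp01 (snd z)) \<partial>M)"
  proof (rule integral_cong_AE)
    have "(\<lambda>z. C (clamp01 (fst z)) (clamp01 (snd z))) \<in> borel_measurable M"
      using borel_measurable_copula_clamp[OF C] sets by (simp cong: measurable_cong_sets)
    then show "(\<lambda>z. C (clamp01 (fst z)) (clamp01 (snd z))) \<in> borel_measurable M"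
      and "(\<lambda>z. indicator unit_square z *\<^sub>R C (clamp01 (fst z)) (clamp01 (snd z))) \<in> borel_measurable M"
      using sets by (auto intro!: borel_measurable_scaleR borel_measurable_indicator)
    show "AE z in M. indicator unit_square z *\<^sub>R C (clamp01 (fst z)) (clamp01 (snd z)) =
        C (clamp01 (fst z)) (clamp01 (snd z))"
      using has_copula_AE[OF M] by eventually_elim simp
  qed
  finally show ?thesis
    unfolding kendall_tau_def concordance_def copula_measure_eqI[OF C M] by simp
qed

lemma has_copula_integrable_snd:
  assumes C: "copula C" and M: "has_copula M C"
  shows "integrable M (\<lambda>z. clamp01 (snd z))"
proof -
  interpret prob_space M
    using C M by (rule has_copula_prob_space)
  have "(\<lambda>z. clamp01 (snd z)) \<in> borel_measurable borel"
    by (intro borel_measurable_continuous_onI continuous_on_compose2[OF continuous_clamp01[of UNIV]] continuous_intros) auto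
  then show ?thesis
    using M unfolding has_copula_def
    by (intro integrable_const_bound[of _ 1]) (auto cong: measurable_cong_sets)
qed

text \<open>Since C 1 v = v, the second marginal has the distribution function of the uniform law on
  [0, 1], whose mean is known.\<close>

lemma has_copula_integral_snd:
  assumes C: "copula C" and M: "has_copula M C"
  shows "(\<integral>z. clamp01 (snd z) \<partial>M) = 1 / 2"
proof -
  interpret prob_space M
    using C M by (rule has_copula_prob_space)
  have sets[measurable_cong]: "sets M = sets borel"
    using M unfolding has_copula_def by simp
  have space: "space M = UNIV"
    using sets_eq_imp_space_eq[OF sets] by simp
  have snd_meas[measurable]: "snd \<in> borel_measurable M"
    using sets by (simp add: borel_measurable_continuous_onI continuous_on_snd cong: measurable_cong_sets)
  let ?U = "uniform_measure lborel {0..1::real}"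
  have "distr M borel snd = ?U"
  proof (rule cdf_unique)
    show "real_distribution (distr M borel snd)"
      by (intro real_distribution.intro prob_space_distr) (auto simp: real_distribution_axioms_def)
    show "real_distribution ?U"
      by (intro real_distribution.intro prob_space_uniform_measure) (auto simp: real_distribution_axioms_def)
    show "cdf (distr M borel snd) = cdf ?U"
    proof
      fix v
      have "emeasure M (snd -` {..v} \<inter> space M) = emeasure M {..(1, v)}"
      proof (rule emeasure_eq_AE)
        show "AE z in M. (z \<in> snd -` {..v} \<inter> space M) = (z \<in> {..(1, v)})"
          using has_copula_AE[OF M] by eventually_elim (auto simp: unit_square_def less_eq_prod_def space)
        show "snd -` {..v} \<inter> space M \<in> events"
          by measurable
      qed (simp add: sets)
      also have "\<dots> = ennreal (clamp01 v)"
        using has_copula_atMost[OF M C, of 1 v] copula_bdry[OF C, of "clamp01 v"] by simp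
      finally have "cdf (distr M borel snd) v = clamp01 v"
        by (simp add: cdf_def measure_def emeasure_distr)
      moreover have "{0..1} \<inter> {..v} = {0..min 1 v}"
        by auto
      then have "cdf ?U v = clamp01 v"
        by (auto simp: cdf_def measure_uniform_measure clamp01_def)
      ultimately show "cdf (distr M borel snd) v = cdf ?U v"
        by simp
    qed
  qed
  then have "distr M lborel snd = ?U"
    by (simp cong: distr_cong)
  then have "distributed M lborel snd (\<lambda>x. ennreal (indicator {0..1::real} x / measure lborel {0..1::real}))"
    by (auto simp: distributed_def uniform_measure_def divide_ennreal content_real intro!: density_cong split: split_indicator)
  then have "expectation snd = (0 + 1) / 2"
    by (rule uniform_distributed_expectation)
  moreover have "(\<integral>z. clamp01 (snd z) \<partial>M) = expectation snd"
  proof (rule integral_cong_AE)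
    show "AE z in M. clamp01 (snd z) = snd z"
      using has_copula_AE[OF M] by eventually_elim (auto simp: unit_square_def)
  qed measurable
  ultimately show ?thesis
    by simp
qed

text \<open>\<open>v - C u v\<close> is the mass of (u, 1] x (0, v], and this rectangle grows as u
  decreases and v increases.\<close>

lemma copula_snd_diff_ge:
  assumes C: "copula C" and a: "0 \<le> u" "u \<le> a" "a \<le> 1" and b: "0 \<le> b" "b \<le> v" "v \<le> 1"
  shows "b - C a b \<le> v - C u v"
  using copula_rect_nonneg[OF C a, of 0 v]
    copula_rect_nonneg[OF C, of a 1 b v] copula_bdry[OF C] a b
  by (auto simp: rect_def)

lemma kendall_tau_ge:
  assumes C: "copula C" and a: "0 \<le> a" "a \<le> 1" and b: "0 \<le> b" "b \<le> 1"
  shows "4 * C a b * (1 - a - b + C a b) - 1 \<le> kendall_tau C"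
proof -
  let ?M = "copula_measure C" and ?f = "\<lambda>z. C (clamp01 (fst z)) (clamp01 (snd z))"
  let ?Q = "{a<..1} \<times> {b<..1}"
  have M: "has_copula ?M C"
    using C by (rule has_copula_copula_measure)
  interpret prob_space ?M
    using C M by (rule has_copula_prob_space)
  have Q: "?Q \<in> events"
    using M by (simp add: has_copula_def borel_Times)
  have "measure ?M ?Q = 1 - a - b + C a b"
    using emeasure_copula_rect[OF C M a(1) a(2) order_refl b(1) b(2) order_refl]
      copula_rect_nonneg[OF C a(1) a(2) order_refl b(1) b(2) order_refl]
      copula_bdry[OF C a] copula_bdry[OF C b] copula_bdry[OF C, of 1]
    by (simp add: measure_def rect_def)
  then have "C a b * (1 - a - b + C a b) = (\<integral>z. C a b * indicator ?Q z \<partial>?M)"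
    using Q by (simp add: Bochner_Integration.integral_mult_right_zero)
  also have "\<dots> \<le> (\<integral>z. ?f z \<partial>?M)"
  proof (rule integral_mono)
    show "integrable ?M (\<lambda>z. C a b * indicator ?Q z)"
      using Q by (intro integrable_mult_right integrable_real_indicator) (auto simp: emeasure_eq_measure)
    show "integrable ?M ?f"
      using C M by (intro integrable_copula_clamp)
    fix z
    show "C a b * indicator ?Q z \<le> ?f z"
    proof (cases "z \<in> ?Q")
      case True
      then show ?thesis
        using copula_increment(1)[OF C a(1) _ _ b, of "fst z"]
          copula_increment(3)[OF C b(1), of "snd z" "fst z"] a b by auto
    next
      case False
      then show ?thesis
        using copula_bounds(1)[OF C] by simp
    qed
  qed
  finally show ?thesis
    using kendall_tau_eq[OF C M] by simp
qed

lemma kendall_tau_le: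
  assumes C: "copula C" and a: "0 \<le> a" "a \<le> 1" and b: "0 \<le> b" "b \<le> 1"
  shows "kendall_tau C \<le> 1 - 4 * (a - C a b) * (b - C a b)"
proof -
  let ?M = "copula_measure C" and ?f = "\<lambda>z. C (clamp01 (fst z)) (clamp01 (snd z))"
  let ?Q = "{0<..a} \<times> {b<..1}"
  have M: "has_copula ?M C"
    using C by (rule has_copula_copula_measure)
  interpret prob_space ?M
    using C M by (rule has_copula_prob_space)
  have Q: "?Q \<in> events"
    using M by (simp add: has_copula_def borel_Times)
  have f_int: "integrable ?M ?f"
    using C M by (intro integrable_copula_clamp)
  have snd_int: "integrable ?M (\<lambda>z. clamp01 (snd z))"
    using C M by (intro has_copula_integrable_snd)
  have "measure ?M ?Q = a - C a b"
    using emeasure_copula_rect[OF C M order_refl a b(1) b(2) order_refl]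
      copula_rect_nonneg[OF C order_refl a b(1) b(2) order_refl]
      copula_bdry[OF C a] copula_bdry[OF C b] copula_bdry[OF C, of 1]
    by (simp add: measure_def rect_def)
  \<comment> \<open>\<open>a - C a b\<close> is the mass of \<open>?Q\<close>, and
    \<open>b - C a b\<close> is the lower bound of the integrand on it.\<close>
  then have "(b - C a b) * (a - C a b) = (\<integral>z. (b - C a b) * indicator ?Q z \<partial>?M)"
    using Q by (simp add: Bochner_Integration.integral_mult_right_zero)
  also have "\<dots> \<le> (\<integral>z. clamp01 (snd z) - ?f z \<partial>?M)"
  proof (rule integral_mono)
    show "integrable ?M (\<lambda>z. (b - C a b) * indicator ?Q z)"
      using Q by (intro integrable_mult_right integrable_real_indicator) (auto simp: emeasure_eq_measure)
    show "integrable ?M (\<lambda>z. clamp01 (snd z) - ?f z)"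
      using snd_int f_int by (rule Bochner_Integration.integrable_diff)
    fix z
    show "(b - C a b) * indicator ?Q z \<le> clamp01 (snd z) - ?f z"
    proof (cases "z \<in> ?Q")
      case True
      then show ?thesis
        using copula_snd_diff_ge[OF C _ _ a(2) b(1), of "fst z" "snd z"] a b by auto
    next
      case False
      then show ?thesis
        using copula_bounds(3)[OF C] by simp
    qed
  qed
  also have "\<dots> = 1 / 2 - (\<integral>z. ?f z \<partial>?M)"
    using snd_int f_int by (simp add: has_copula_integral_snd[OF C M])
  finally show ?thesis
    using kendall_tau_eq[OF C M] by (simp add: algebra_simps)
qed

lemma asymmetry_kendall_tau_pair:
  assumes C: "copula C" and a: "0 \<le> a" "a \<le> 1" and b: "0 \<le> b" "b \<le> 1" and d: "0 \<le> C a b - C b a"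
  defines "d \<equiv> C a b - C b a"
  shows "d \<le> 1 / 3" "kendall_tau C \<le> 1 - 8 * d\<^sup>2" "4 * d\<^sup>2 - 1 \<le> kendall_tau C"
proof -
  \<comment> \<open>Both cases pass through the diagonal value \<open>C b b\<close>: one leg is
    monotone, the other has slope at most 1.\<close>
  have ba: "d \<le> \<bar>b - a\<bar>"
    using copula_increment(1,4)[OF C, of a b b] copula_increment(2,3)[OF C, of b a b] a b
    unfolding d_def by (cases "a \<le> b") auto
  have da: "d \<le> a - C b a" "d \<le> b - C b a"
    using copula_bounds[OF C a b] unfolding d_def by auto
  have ge: "d \<le> C a b" "d \<le> 1 - a - b + C a b"
    using copula_bounds[OF C b a] unfolding d_def by auto
  \<comment> \<open>For a <= b: d <= C a b <= a, d <= b - a, and d <= 1 - a - b + C a b <= 1 - b.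
    Adding gives 3 d <= 1.\<close>
  show "d \<le> 1 / 3"
    using ba da ge copula_bounds[OF C b a] copula_bounds[OF C a b] by (cases "a \<le> b") auto
  have "d * (2 * d) \<le> (a - C b a) * (b - C b a)"
  proof (cases "a \<le> b")
    case True
    then show ?thesis
      using ba da d by (intro mult_mono) (auto simp: d_def)
  next
    case False
    then have "d * (2 * d) \<le> (b - C b a) * (a - C b a)"
      using ba da d by (intro mult_mono) (auto simp: d_def)
    then show ?thesis by (simp add: mult.commute)
  qed
  then show "kendall_tau C \<le> 1 - 8 * d\<^sup>2"
    using kendall_tau_le[OF C b a] by (simp add: power2_eq_square algebra_simps)
  have "d * d \<le> C a b * (1 - a - b + C a b)"
    using ge d by (intro mult_mono) (auto simp: d_def)
  then show "4 * d\<^sup>2 - 1 \<le> kendall_tau C"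
    using kendall_tau_ge[OF C a b] by (simp add: power2_eq_square mult.assoc)
qed

section \<open>Shuffles\<close>

text \<open>With the first side half-open, C 0 t = 0 holds because the set is empty, and horizontal
  increments are masses of set differences.\<close>

lemma copula_of_finite_measure:
  assumes "finite_measure M" and sets: "sets M = sets borel"
    and C: "\<And>u v. u \<in> {0..1} \<Longrightarrow> v \<in> {0..1} \<Longrightarrow> measure M ({0<..u} \<times> {0..v}) = C u v"
    and bdry: "\<And>t. t \<in> {0..1} \<Longrightarrow> C t 1 = t" "\<And>t. t \<in> {0..1} \<Longrightarrow> C 1 t = t"
  shows "copula C"
proof -
  interpret finite_measure M by fact
  have sets': "A \<times> B \<in> sets M" if "A \<in> sets borel" "B \<in> sets borel" for A B :: "real set"
    using that by (simp add: sets borel_Times)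
  have inc: "0 \<le> C u2 v2 - C u2 v1 - C u1 v2 + C u1 v1"
    if u: "0 \<le> u1" "u1 \<le> u2" "u2 \<le> 1" and v: "0 \<le> v1" "v1 \<le> v2" "v2 \<le> 1" for u1 u2 v1 v2
  proof -
    have *: "measure M ({u1<..u2} \<times> {0..v}) = C u2 v - C u1 v" if "v \<in> {0..1}" for v
    proof -
      have "{u1<..u2} \<times> {0..v} = {0<..u2} \<times> {0..v} - {0<..u1} \<times> {0..v}"
        using u by auto
      then show ?thesis
        using u that by (simp only:) (subst finite_measure_Diff, auto intro!: sets' simp: C)
    qed
    have "measure M ({u1<..u2} \<times> {0..v1}) \<le> measure M ({u1<..u2} \<times> {0..v2})"
      using v by (intro finite_measure_mono sets') auto
    then show ?thesis
      using v by (simp add: *)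
  qed
  have "C 0 t = 0" if "t \<in> {0..1}" for t
    using C[of 0 t] that by simp
  \<comment> \<open>The bottom edge is null, since its mass is C 1 0 = 0 by the boundary
    condition.\<close>
  moreover have "C t 0 = 0" if "t \<in> {0..1}" for t
  proof -
    have "measure M ({0<..t} \<times> {0..0}) \<le> measure M ({0<..1} \<times> {0..0})"
      using that by (intro finite_measure_mono sets') auto
    then show ?thesis
      using C[of t 0] C[of 1 0] bdry(2)[of 0] that measure_nonneg[of M "{0<..t} \<times> {0..0}"] by simp
  qed
  ultimately show ?thesis
    using bdry inc unfolding copula_def by auto
qed

text \<open>\<open>C\<close> is the distribution function of the image of Lebesgue measure on (0, 1]
  under t -> (t, s t). All mass lies on the graph of \<open>s\<close>, so tau becomes a
  one-dimensional integral. That \<open>s\<close> preserves Lebesgue measure is contained in C 1 t =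
  t.\<close>

lemma copula_shuffle:
  assumes s[measurable]: "s \<in> borel_measurable borel" and s01: "\<And>t. t \<in> {0<..1} \<Longrightarrow> s t \<in> {0..1}"
    and C: "\<And>u v. u \<in> {0..1} \<Longrightarrow> v \<in> {0..1} \<Longrightarrow>
      emeasure lborel ({0<..u} \<inter> {t. s t \<le> v}) = ennreal (C u v)"
    and C0: "\<And>u v. 0 \<le> C u v"
    and bdry: "\<And>t. t \<in> {0..1} \<Longrightarrow> C t 1 = t" "\<And>t. t \<in> {0..1} \<Longrightarrow> C 1 t = t"
  shows "copula C \<and> kendall_tau C = 4 * (LINT t:{0<..1}|lborel. C t (s t)) - 1"
proof -
  let ?N = "restrict_space lborel {0<..1}"
  define M where "M = distr ?N (borel :: (real \<times> real) measure) (\<lambda>t. (t, s t))"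
  have meas[measurable]: "(\<lambda>t. (t, s t)) \<in> ?N \<rightarrow>\<^sub>M (borel :: (real \<times> real) measure)"
    unfolding borel_prod[symmetric] by (intro measurable_restrict_space1) measurable
  have sets: "sets M = sets borel"
    by (simp add: M_def)
  have em: "emeasure M (A \<times> B) = emeasure lborel ({0<..1} \<inter> {t. t \<in> A \<and> s t \<in> B})"
    if [measurable]: "A \<in> sets borel" "B \<in> sets borel" for A B
  proof -
    have "emeasure M (A \<times> B) = emeasure ?N ((\<lambda>t. (t, s t)) -` (A \<times> B) \<inter> space ?N)"
      unfolding M_def by (intro emeasure_distr meas) (simp add: borel_Times)
    also have "(\<lambda>t. (t, s t)) -` (A \<times> B) \<inter> space ?N = {0<..1} \<inter> {t. t \<in> A \<and> s t \<in> B}"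
      by (auto simp: space_restrict_space)
    also have "emeasure ?N \<dots> = emeasure lborel \<dots>"
      by (intro emeasure_restrict_space) auto
    finally show ?thesis .
  qed
  \<comment> \<open>The closed form of \<open>A\<close> is for \<open>has_copula\<close>, the
    half-open one for \<open>copula_of_finite_measure\<close>.\<close>
  have rect: "emeasure M (A \<times> {0..v}) = ennreal (C u v)"
    if "u \<in> {0..1}" "v \<in> {0..1}" "A = {0..u} \<or> A = {0<..u}" for A u v
  proof -
    have "{0<..1} \<inter> {t. t \<in> A \<and> s t \<in> {0..v}} = {0<..u} \<inter> {t. s t \<le> v}"
      using that s01 by auto
    then show ?thesis
      using that C by (subst em) auto
  qed
  have UNIV: "emeasure M (space M) = 1"
    using em[of UNIV UNIV] sets_eq_imp_space_eq[OF sets] by simp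
  interpret prob_space M
    using UNIV by (rule prob_spaceI)
  have C': "copula C"
  proof (rule copula_of_finite_measure[OF _ sets _ bdry])
    show "finite_measure M"
      by unfold_locales
    show "measure M ({0<..u} \<times> {0..v}) = C u v" if "u \<in> {0..1}" "v \<in> {0..1}" for u v
      using rect[OF that] C0 by (simp add: measure_def)
  qed
  have "has_copula M C"
    unfolding has_copula_def
  proof (intro conjI ballI sets)
    have "emeasure M unit_square = 1"
      using rect[of 1 1 "{0..1}"] bdry(1)[of 1] by (simp add: unit_square_def)
    then have "emeasure M (space M - unit_square) = 0"
      by (subst emeasure_compl) (auto simp: UNIV sets)
    then show "emeasure M (- unit_square) = 0"
      using sets_eq_imp_space_eq[OF sets] by (simp add: Compl_eq_Diff_UNIV)
  qed (use rect in auto)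
  then have "kendall_tau C = 4 * (\<integral>z. C (clamp01 (fst z)) (clamp01 (snd z)) \<partial>M) - 1"
    by (rule kendall_tau_eq[OF C'])
  also have "(\<integral>z. C (clamp01 (fst z)) (clamp01 (snd z)) \<partial>M) = (\<integral>t. C (clamp01 t) (clamp01 (s t)) \<partial>?N)"
    unfolding M_def by (subst integral_distr[OF meas borel_measurable_copula_clamp[OF C']]) simp
  also have "\<dots> = (LINT t:{0<..1}|lborel. C (clamp01 t) (clamp01 (s t)))"
    by (subst integral_restrict_space) (auto simp: set_lebesgue_integral_def)
  also have "\<dots> = (LINT t:{0<..1}|lborel. C t (s t))"
    using s01 by (intro set_lebesgue_integral_cong) auto
  finally show ?thesis
    using C' by simp
qed

text \<open>The length of the intersection of (p, q] and [c, e], which is 0 if they do not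
  meet.\<close>

definition overlap :: "real \<Rightarrow> real \<Rightarrow> real \<Rightarrow> real \<Rightarrow> real" where
  "overlap p q c e = max 0 (min q e - max p c)"

lemma overlap_nonneg: "0 \<le> overlap p q c e"
  by (simp add: overlap_def)

lemma emeasure_overlap: "emeasure lborel ({p<..q} \<inter> {c..e}) = ennreal (overlap p q c e)"
proof (cases "c \<le> p")
  case True
  then have "{p<..q} \<inter> {c..e} = {p<..min q e}"
    by auto
  then show ?thesis
    using True by (cases "p \<le> min q e") (auto simp: overlap_def max_def not_le intro!: ennreal_neg)
next
  case False
  then have "{p<..q} \<inter> {c..e} = {c..min q e}"
    by auto
  then show ?thesis
    using False by (auto simp: overlap_def max_def not_le emeasure_lborel_Icc_eq intro!: ennreal_neg)
qed

lemma emeasure_overlap3: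
  assumes "p \<le> q" "q \<le> r"
  shows "emeasure lborel ({p<..q} \<inter> {a..b} \<union> ({q<..r} \<inter> {c..d} \<union> {r<..w} \<inter> {e..f})) =
    ennreal (overlap p q a b + overlap q r c d + overlap r w e f)"
  using assms
  by (subst plus_emeasure[symmetric], simp, simp, force, subst plus_emeasure[symmetric], simp, simp, force)
     (simp add: emeasure_overlap overlap_nonneg add.assoc)

text \<open>
  The copula of \<open>(T, s T)\<close> with \<open>T\<close> uniform, where \<open>s\<close> exchanges the intervals \<open>(0, 2d]\<close> and
  \<open>(2d, 3d]\<close> by translations and is the identity on \<open>(3d, 1]\<close>.
\<close>

definition swap_copula :: "real \<Rightarrow> real \<Rightarrow> real \<Rightarrow> real" where
  "swap_copula d u v = overlap 0 (2 * d) 0 (min u (v - d)) +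
     overlap (2 * d) (3 * d) 0 (min u (v + 2 * d)) + overlap (3 * d) 1 0 (min u v)"

text \<open>
  Here \<open>s t\<close> is \<open>1 - d - t\<close> on \<open>(0, d]\<close>, \<open>1 + d - t\<close> on \<open>(d, 2d]\<close> and \<open>1 - t\<close> on \<open>(2d, 1]\<close>.
\<close>

definition antiswap_copula :: "real \<Rightarrow> real \<Rightarrow> real \<Rightarrow> real" where
  "antiswap_copula d u v = overlap 0 d (1 - d - v) u +
     overlap d (2 * d) (1 + d - v) u + overlap (2 * d) 1 (1 - v) u"

section \<open>Kendall's tau of the two families of shuffles\<close>

lemma LINT_id_01: "set_integrable lborel {0<..1} (\<lambda>t::real. t)" "(LINT t:{0<..1}|lborel. t) = (1 / 2 :: real)"
proof -
  have AE: "AE t in lborel. indicator {0<..1} t *\<^sub>R t = t ^ 1 * indicator {0..1} (t :: real)"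
    using AE_lborel_singleton[of "0 :: real"] by eventually_elim (auto simp: indicator_def)
  have "integrable lborel (\<lambda>t. t ^ 1 * indicator {0..1} (t :: real))"
    by (rule borel_integrable_atLeastAtMost) (auto intro!: continuous_intros)
  then show "set_integrable lborel {0<..1} (\<lambda>t::real. t)"
    unfolding set_integrable_def by (subst integrable_cong_AE[OF _ _ AE]) auto
  have "(LINT t:{0<..1}|lborel. t) = (\<integral>t. t ^ 1 * indicator {0..1} t \<partial>lborel :: real)"
    unfolding set_lebesgue_integral_def by (intro integral_cong_AE AE) auto
  also have "\<dots> = 1 / 2"
    by (subst integral_power) auto
  finally show "(LINT t:{0<..1}|lborel. t) = (1 / 2 :: real)" .
qed

lemma LINT_indicator_01:
  assumes "0 \<le> p" "p \<le> q" "q \<le> 1"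
  shows "set_integrable lborel {0<..1::real} (\<lambda>t. c * indicator {p<..q} t :: real)"
    "(LINT t:{0<..1}|lborel. c * indicator {p<..q} t) = (c * (q - p) :: real)"
proof -
  have eq: "(\<lambda>t. indicator {0<..1} t *\<^sub>R (c * indicator {p<..q} t)) = (\<lambda>t. c * indicator {p<..q} t :: real)"
    using assms by (auto simp: indicator_def fun_eq_iff)
  show "set_integrable lborel {0<..1::real} (\<lambda>t. c * indicator {p<..q} t :: real)"
    unfolding set_integrable_def eq
    using assms by (intro integrable_mult_right integrable_real_indicator) auto
  show "(LINT t:{0<..1}|lborel. c * indicator {p<..q} t) = (c * (q - p) :: real)"
    unfolding set_lebesgue_integral_def eq using assms by simp
qed

lemma
  assumes d: "0 \<le> d" "d \<le> 1 / 3"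
  shows copula_swap: "copula (swap_copula d)"
    and kendall_tau_swap: "kendall_tau (swap_copula d) = 1 - 8 * d\<^sup>2"
proof -
  define s where "s t = (if t \<le> 2 * d then t + d else if t \<le> 3 * d then t - 2 * d else t)" for t :: real
  have "copula (swap_copula d) \<and> kendall_tau (swap_copula d) = 4 * (LINT t:{0<..1}|lborel. swap_copula d t (s t)) - 1"
  proof (rule copula_shuffle)
    show "s \<in> borel_measurable borel"
      unfolding s_def[abs_def] by measurable
    show "s t \<in> {0..1}" if "t \<in> {0<..1}" for t
      using that d by (auto simp: s_def)
    fix u v :: real assume uv: "u \<in> {0..1}" "v \<in> {0..1}"
    have "{0<..u} \<inter> {t. s t \<le> v} = {0<..2 * d} \<inter> {0..min u (v - d)} \<union>
        ({2 * d<..3 * d} \<inter> {0..min u (v + 2 * d)} \<union> {3 * d<..1} \<inter> {0..min u v})"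
      using uv d by (auto simp: s_def split: if_splits)
    then show "emeasure lborel ({0<..u} \<inter> {t. s t \<le> v}) = ennreal (swap_copula d u v)"
      using d unfolding swap_copula_def by (simp only:) (subst emeasure_overlap3, auto)
  next
    show "0 \<le> swap_copula d u v" for u v
      by (simp add: swap_copula_def overlap_def)
    show "swap_copula d t 1 = t" "swap_copula d 1 t = t" if "t \<in> {0..1}" for t
      using that d by (auto simp: swap_copula_def overlap_def max_def min_def)
  qed
  \<comment> \<open>At a point of the graph over (2d, 3d], exactly the mass over (0, 2d] lies to the
    left but higher; elsewhere everything to the left is also below.\<close>
  moreover have "(LINT t:{0<..1}|lborel. swap_copula d t (s t)) =
      (LINT t:{0<..1}|lborel. t - 2 * d * indicator {2 * d<..3 * d} t)"
  proof (intro set_lebesgue_integral_cong allI impI)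
    fix t :: real assume "t \<in> {0<..1}"
    then show "swap_copula d t (s t) = t - 2 * d * indicator {2 * d<..3 * d} t"
      using d by (auto simp: swap_copula_def overlap_def s_def)
  qed simp
  moreover have "(LINT t:{0<..1}|lborel. t - 2 * d * indicator {2 * d<..3 * d} t) = 1 / 2 - 2 * d * (3 * d - 2 * d)"
    using d by (subst set_integral_diff, intro LINT_id_01, intro LINT_indicator_01, simp_all only: LINT_id_01)
      (subst LINT_indicator_01, auto)
  ultimately show "copula (swap_copula d)" "kendall_tau (swap_copula d) = 1 - 8 * d\<^sup>2"
    by (auto simp: power2_eq_square)
qed

lemma
  assumes d: "0 \<le> d" "d \<le> 1 / 3"
  shows copula_antiswap: "copula (antiswap_copula d)"
    and kendall_tau_antiswap: "kendall_tau (antiswap_copula d) = 4 * d\<^sup>2 - 1"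
proof -
  define s where "s t = (if t \<le> d then 1 - d - t else if t \<le> 2 * d then 1 + d - t else 1 - t)" for t :: real
  have "copula (antiswap_copula d) \<and> kendall_tau (antiswap_copula d) = 4 * (LINT t:{0<..1}|lborel. antiswap_copula d t (s t)) - 1"
  proof (rule copula_shuffle)
    show "s \<in> borel_measurable borel"
      unfolding s_def[abs_def] by measurable
    show "s t \<in> {0..1}" if "t \<in> {0<..1}" for t
      using that d by (auto simp: s_def)
    fix u v :: real assume uv: "u \<in> {0..1}" "v \<in> {0..1}"
    have "{0<..u} \<inter> {t. s t \<le> v} = {0<..d} \<inter> {1 - d - v..u} \<union>
        ({d<..2 * d} \<inter> {1 + d - v..u} \<union> {2 * d<..1} \<inter> {1 - v..u})"
      using uv d by (auto simp: s_def split: if_splits)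
    then show "emeasure lborel ({0<..u} \<inter> {t. s t \<le> v}) = ennreal (antiswap_copula d u v)"
      using d unfolding antiswap_copula_def by (simp only:) (subst emeasure_overlap3, auto)
  next
    show "0 \<le> antiswap_copula d u v" for u v
      by (simp add: antiswap_copula_def overlap_def)
    show "antiswap_copula d t 1 = t" "antiswap_copula d 1 t = t" if "t \<in> {0..1}" for t
      using that d by (auto simp: antiswap_copula_def overlap_def max_def min_def)
  qed
  \<comment> \<open>Each piece is decreasing, so a point has nothing to its lower left within its
    own piece. Only points over (d, 2d] lie above an earlier piece, the whole first one of mass
    d.\<close>
  moreover have "(LINT t:{0<..1}|lborel. antiswap_copula d t (s t)) =
      (LINT t:{0<..1}|lborel. d * indicator {d<..2 * d} t)"
  proof (intro set_lebesgue_integral_cong allI impI)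
    fix t :: real assume "t \<in> {0<..1}"
    then show "antiswap_copula d t (s t) = d * indicator {d<..2 * d} t"
      using d by (auto simp: antiswap_copula_def overlap_def s_def)
  qed simp
  moreover have "(LINT t:{0<..1}|lborel. d * indicator {d<..2 * d} t) = d * (2 * d - d)"
    using d by (intro LINT_indicator_01) auto
  ultimately show "copula (antiswap_copula d)" "kendall_tau (antiswap_copula d) = 4 * d\<^sup>2 - 1"
    by (auto simp: power2_eq_square)
qed

section \<open>Mixtures and attainment\<close>

definition mix_copula :: "real \<Rightarrow> (real \<Rightarrow> real \<Rightarrow> real) \<Rightarrow> (real \<Rightarrow> real \<Rightarrow> real) \<Rightarrow> real \<Rightarrow> real \<Rightarrow> real" where
  "mix_copula p C D u v = p * C u v + (1 - p) * D u v"

lemma copula_mix: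
  assumes C: "copula C" and D: "copula D" and p: "0 \<le> p" "p \<le> 1"
  shows "copula (mix_copula p C D)"
proof -
  have "0 \<le> mix_copula p C D u2 v2 - mix_copula p C D u2 v1 - mix_copula p C D u1 v2 + mix_copula p C D u1 v1"
    if "0 \<le> u1" "u1 \<le> u2" "u2 \<le> 1" "0 \<le> v1" "v1 \<le> v2" "v2 \<le> 1" for u1 u2 v1 v2
  proof -
    have "0 \<le> p * rect C u1 u2 v1 v2 + (1 - p) * rect D u1 u2 v1 v2"
      using p that by (intro add_nonneg_nonneg mult_nonneg_nonneg copula_rect_nonneg C D) auto
    then show ?thesis
      by (simp add: mix_copula_def rect_def algebra_simps)
  qed
  moreover have "mix_copula p C D t 0 = 0 \<and> mix_copula p C D 0 t = 0 \<and> mix_copula p C D t 1 = t \<and> mix_copula p C D 1 t = t"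
    if "t \<in> {0..1}" for t
    using that copula_bdry[OF C, of t] copula_bdry[OF D, of t] by (simp add: mix_copula_def algebra_simps)
  ultimately show ?thesis
    unfolding copula_def by blast
qed

text \<open>The measure of a mixture is the mixture of the measures, realised as a Bernoulli choice
  between them. Tau is thus an affine function of a bilinear form with four cross integrals
  \<open>J\<close>, which do not depend on \<open>p\<close>.\<close>

lemma kendall_tau_mix:
  assumes C: "copula C" and D: "copula D"
  obtains a b c where "\<And>p. 0 \<le> p \<Longrightarrow> p \<le> 1 \<Longrightarrow> kendall_tau (mix_copula p C D) = a * p\<^sup>2 + b * p + c"
proof -
  define K where "K B = (if B then copula_measure C else copula_measure D)" for B
  have MC: "has_copula (K True) C" and MD: "has_copula (K False) D"
    using has_copula_copula_measure C D by (auto simp: K_def)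
  then have sets_K: "sets (K B) = sets borel" for B
    by (cases B) (auto simp: has_copula_def)
  have K: "K \<in> measurable (measure_pmf q) (subprob_algebra borel)" for q
  proof -
    have "K B \<in> space (subprob_algebra borel)" for B
      using has_copula_prob_space[OF C MC] has_copula_prob_space[OF D MD] sets_K
      by (cases B) (auto simp: space_subprob_algebra intro: prob_space_imp_subprob_space)
    then show ?thesis by simp
  qed
  define J where "J B E = (\<integral>z. E (clamp01 (fst z)) (clamp01 (snd z)) \<partial>K B)" for B and E :: "real \<Rightarrow> real \<Rightarrow> real"
  have int: "integrable (K B) (\<lambda>z. E (clamp01 (fst z)) (clamp01 (snd z)))" if "copula E" for B E
    using that MC MD C D by (cases B) (auto intro: integrable_copula_clamp)
  have "kendall_tau (mix_copula p C D) = 4 * (p * (p * J True C + (1 - p) * J True D) +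
      (1 - p) * (p * J False C + (1 - p) * J False D)) - 1" if p: "0 \<le> p" "p \<le> 1" for p
  proof -
    let ?E = "mix_copula p C D"
    let ?f = "\<lambda>z. ?E (clamp01 (fst z)) (clamp01 (snd z))"
    define M where "M = measure_pmf (bernoulli_pmf p) \<bind> K"
    have E: "copula ?E"
      using C D p by (rule copula_mix)
    have nonneg: "0 \<le> ?f z" for z
      using copula_bounds(1)[OF E] by simp
    have sets: "sets M = sets borel"
      unfolding M_def by (rule sets_bind) (auto simp: sets_K)
    have em: "emeasure M X = ennreal p * emeasure (K True) X + ennreal (1 - p) * emeasure (K False) X"
      if "X \<in> sets borel" for X
      unfolding M_def using that p
      by (subst emeasure_bind[OF _ K]) (auto simp: mult.commute)
    have M: "has_copula M ?E"
      unfolding has_copula_def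
    proof (intro conjI ballI sets)
      show "emeasure M (- unit_square) = 0"
        using MC MD by (subst em) (auto simp: has_copula_def)
      fix u v :: real assume uv: "u \<in> {0..1}" "v \<in> {0..1}"
      have "emeasure M ({0..u} \<times> {0..v}) = ennreal p * ennreal (C u v) + ennreal (1 - p) * ennreal (D u v)"
        using MC MD uv by (subst em) (auto simp: has_copula_def borel_Times)
      also have "\<dots> = ennreal (?E u v)"
        using p uv copula_bounds(1)[OF C, of u v] copula_bounds(1)[OF D, of u v]
        by (simp add: mix_copula_def ennreal_mult' ennreal_plus)
      finally show "emeasure M ({0..u} \<times> {0..v}) = ennreal (?E u v)" .
    qed
    have J: "(\<integral>z. ?f z \<partial>K B) = p * J B C + (1 - p) * J B D" for B
      using int[OF C, of B] int[OF D, of B] unfolding J_def by (simp add: mix_copula_def)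
    have J0: "0 \<le> (\<integral>z. ?f z \<partial>K B)" for B
      by (simp add: nonneg integral_nonneg)
    \<comment> \<open>The integrand is nonnegative, so the integral over the bind can be computed
      with \<open>nn_integral_bind\<close> and translated back.\<close>
    have nn: "(\<integral>\<^sup>+z. ?f z \<partial>K B) = ennreal (\<integral>z. ?f z \<partial>K B)" for B
      using int[OF E] nonneg by (intro nn_integral_eq_integral) auto
    have "(\<integral>\<^sup>+z. ?f z \<partial>M) = ennreal p * ennreal (\<integral>z. ?f z \<partial>K True) + ennreal (1 - p) * ennreal (\<integral>z. ?f z \<partial>K False)"
      unfolding M_def nn[symmetric] using p borel_measurable_copula_clamp[OF E]
      by (subst nn_integral_bind[OF _ K]) (auto simp: mult.commute)
    also have "\<dots> = ennreal (p * (\<integral>z. ?f z \<partial>K True) + (1 - p) * (\<integral>z. ?f z \<partial>K False))"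
      using p J0 by (simp add: ennreal_mult' ennreal_plus)
    finally have "(\<integral>z. ?f z \<partial>M) = p * (\<integral>z. ?f z \<partial>K True) + (1 - p) * (\<integral>z. ?f z \<partial>K False)"
      using p J0 borel_measurable_integrable[OF integrable_copula_clamp[OF E M E]]
      by (subst integral_eq_nn_integral) (auto simp: nonneg simp del: ennreal_plus)
    then show ?thesis
      using kendall_tau_eq[OF E M] unfolding J by simp
  qed
  then show thesis
    by (intro that[of "4 * (J True C - J True D - J False C + J False D)"
      "4 * (J True D + J False C - 2 * J False D)" "4 * J False D - 1"])
      (simp add: algebra_simps power2_eq_square)
qed

text \<open>The polynomial is continuous in \<open>p\<close> and takes the values for
  \<open>D\<close> and \<open>C\<close> at 0 and 1, so the intermediate value theorem
  applies.\<close>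

lemma kendall_tau_mix_surj:
  assumes C: "copula C" and D: "copula D" and t: "kendall_tau D \<le> t" "t \<le> kendall_tau C"
  obtains p where "0 \<le> p" "p \<le> 1" "kendall_tau (mix_copula p C D) = t"
proof -
  obtain a b c where abc: "\<And>p. 0 \<le> p \<Longrightarrow> p \<le> 1 \<Longrightarrow> kendall_tau (mix_copula p C D) = a * p\<^sup>2 + b * p + c"
    using kendall_tau_mix[OF C D] by blast
  have "mix_copula 0 C D = D" "mix_copula 1 C D = C"
    by (auto simp: mix_copula_def fun_eq_iff)
  then have "\<exists>p. 0 \<le> p \<and> p \<le> 1 \<and> a * p\<^sup>2 + b * p + c = t"
    using t abc[of 0] abc[of 1] by (intro IVT') (auto intro!: continuous_intros)
  then show thesis
    using abc that by force
qed

section \<open>From pointwise differences to the asymmetry\<close>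

lemma abs_asymmetry:
  assumes C: "copula C" and a: "a \<in> {0..1}" and b: "b \<in> {0..1}"
  defines "d \<equiv> \<bar>C a b - C b a\<bar>"
  shows "d \<le> 1 / 3" "kendall_tau C \<le> 1 - 8 * d\<^sup>2" "4 * d\<^sup>2 - 1 \<le> kendall_tau C"
  using asymmetry_kendall_tau_pair[OF C, of a b] asymmetry_kendall_tau_pair[OF C, of b a] a b
  unfolding d_def by (cases "C b a \<le> C a b"; simp add: power2_commute)+

lemma asymmetry_le:
  assumes "\<And>a b. a \<in> {0..1} \<Longrightarrow> b \<in> {0..1} \<Longrightarrow> \<bar>C a b - C b a\<bar> \<le> B"
  shows "asymmetry C \<le> B"
  unfolding asymmetry_def by (rule cSUP_least) (use assms in \<open>auto simp: unit_square_def\<close>)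

lemma asymmetry_ge:
  assumes C: "copula C" and a: "a \<in> {0..1}" and b: "b \<in> {0..1}"
  shows "\<bar>C a b - C b a\<bar> \<le> asymmetry C"
proof -
  \<comment> \<open>A real supremum dominates its members once the set is bounded above; the
    universal bound 1/3 provides this.\<close>
  have "bdd_above ((\<lambda>(u, v). \<bar>C u v - C v u\<bar>) ` unit_square)"
    using abs_asymmetry(1)[OF C] by (intro bdd_aboveI[of _ "1 / 3"]) (auto simp: unit_square_def)
  then have "(case (a, b) of (u, v) \<Rightarrow> \<bar>C u v - C v u\<bar>) \<le> asymmetry C"
    unfolding asymmetry_def using a b by (intro cSUP_upper) (auto simp: unit_square_def)
  then show ?thesis by simp
qed

text \<open>All three estimates hold for every value of tau, and each branch of the bound selects
  one of them.\<close>

lemma asymmetry_le_bound: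
  assumes C: "copula C"
  shows "asymmetry C \<le> asymmetry_bound (kendall_tau C)"
proof (rule asymmetry_le)
  fix a b :: real assume "a \<in> {0..1}" "b \<in> {0..1}"
  note * = abs_asymmetry[OF C this]
  have "\<bar>C a b - C b a\<bar> \<le> sqrt ((1 + kendall_tau C) / 4)"
    using *(3) by (intro real_le_rsqrt) simp
  moreover have "\<bar>C a b - C b a\<bar> \<le> sqrt ((1 - kendall_tau C) / 8)"
    using *(2) by (intro real_le_rsqrt) simp
  ultimately show "\<bar>C a b - C b a\<bar> \<le> asymmetry_bound (kendall_tau C)"
    using *(1) by (simp add: asymmetry_bound_def)
qed

lemma asymmetry_symmetric:
  assumes C: "copula C" and "\<And>u v. u \<in> {0..1} \<Longrightarrow> v \<in> {0..1} \<Longrightarrow> C u v = C v u"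
  shows "asymmetry C = 0"
  using asymmetry_le[of C 0] asymmetry_ge[OF C, of 0 0] assms(2) by force

lemma asymmetry_eq_bound:
  assumes C: "copula C" and "a \<in> {0..1}" "b \<in> {0..1}" and "asymmetry_bound (kendall_tau C) \<le> C a b - C b a"
  shows "asymmetry C = asymmetry_bound (kendall_tau C)"
  using asymmetry_ge[OF assms(1-3)] asymmetry_le_bound[OF C] assms(4) by simp

text \<open>Here C d (2d) = d and C (2d) d = 0, so \<open>kendall_tau_le\<close> at (2d, d) reads
  tau <= 1 - 8 d^2 and is an equality.\<close>

lemma swap_copula_diff:
  assumes "0 \<le> d" "d \<le> 1 / 3"
  shows "swap_copula d d (2 * d) - swap_copula d (2 * d) d = d"
  using assms by (auto simp: swap_copula_def overlap_def max_def min_def)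

text \<open>Here C d (1 - d) = d and C (1 - d) d = 0, so \<open>kendall_tau_ge\<close> at (d, 1 - d)
  reads 4 d^2 - 1 <= tau and is an equality.\<close>

lemma antiswap_copula_diff:
  assumes "0 \<le> d" "d \<le> 1 / 3"
  shows "antiswap_copula d d (1 - d) - antiswap_copula d (1 - d) d = d"
  using assms by (auto simp: antiswap_copula_def overlap_def max_def min_def)

section \<open>Attainment of both bounds\<close>

lemma ex_symmetric:
  assumes \<tau>: "-1 \<le> \<tau>" "\<tau> \<le> 1"
  shows "\<exists>C. copula C \<and> kendall_tau C = \<tau> \<and> asymmetry C = 0"
proof -
  \<comment> \<open>For d = 0 the maps are t -> t and t -> 1 - t on (0, 1], so on the square these
    are the two Frechet-Hoeffding bounds, both symmetric.\<close>
  have C: "copula (swap_copula 0)" "kendall_tau (swap_copula 0) = 1"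
    and D: "copula (antiswap_copula 0)" "kendall_tau (antiswap_copula 0) = -1"
    using copula_swap[of 0] kendall_tau_swap[of 0] copula_antiswap[of 0] kendall_tau_antiswap[of 0] by auto
  obtain p where p: "0 \<le> p" "p \<le> 1" "kendall_tau (mix_copula p (swap_copula 0) (antiswap_copula 0)) = \<tau>"
    using kendall_tau_mix_surj[OF C(1) D(1)] C D \<tau> by metis
  have sym: "swap_copula 0 u v = swap_copula 0 v u" "antiswap_copula 0 u v = antiswap_copula 0 v u"
    if "u \<in> {0..1}" "v \<in> {0..1}" for u v
    using that by (auto simp: swap_copula_def antiswap_copula_def overlap_def max_def min_def)
  have "copula (mix_copula p (swap_copula 0) (antiswap_copula 0))"
    using C D p by (intro copula_mix)
  moreover from this have "asymmetry (mix_copula p (swap_copula 0) (antiswap_copula 0)) = 0"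
    by (rule asymmetry_symmetric) (use sym in \<open>simp add: mix_copula_def\<close>)
  ultimately show ?thesis
    using p by blast
qed

lemma ex_asymmetry_bound:
  assumes \<tau>: "-1 \<le> \<tau>" "\<tau> \<le> 1"
  shows "\<exists>C. copula C \<and> kendall_tau C = \<tau> \<and> asymmetry C = asymmetry_bound \<tau>"
proof -
  consider "\<tau> \<le> -5/9" | "-5/9 < \<tau>" "\<tau> \<le> 1/9" | "1/9 < \<tau>"
    by linarith
  then show ?thesis
  proof cases
    case 1
    define d where "d = sqrt ((1 + \<tau>) / 4)"
    have "d \<le> 1 / 3"
      unfolding d_def using 1 \<tau> by (intro real_le_lsqrt) (auto simp: power2_eq_square)
    then have d: "0 \<le> d" "d \<le> 1 / 3" "d\<^sup>2 = (1 + \<tau>) / 4"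
      using \<tau> by (auto simp: d_def)
    have C: "copula (antiswap_copula d)" "kendall_tau (antiswap_copula d) = \<tau>"
      using copula_antiswap[OF d(1,2)] kendall_tau_antiswap[OF d(1,2)] d(3) by (auto simp: field_simps)
    have "asymmetry_bound \<tau> = d"
      using 1 by (simp add: asymmetry_bound_def d_def)
    then show ?thesis
      using asymmetry_eq_bound[OF C(1), of d "1 - d"] antiswap_copula_diff[OF d(1,2)] C d by auto
  next
    case 3
    define d where "d = sqrt ((1 - \<tau>) / 8)"
    have "d \<le> 1 / 3"
      unfolding d_def using 3 \<tau> by (intro real_le_lsqrt) (auto simp: power2_eq_square)
    then have d: "0 \<le> d" "d \<le> 1 / 3" "d\<^sup>2 = (1 - \<tau>) / 8"
      using \<tau> by (auto simp: d_def)
    have C: "copula (swap_copula d)" "kendall_tau (swap_copula d) = \<tau>"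
      using copula_swap[OF d(1,2)] kendall_tau_swap[OF d(1,2)] d(3) by (auto simp: field_simps)
    have "asymmetry_bound \<tau> = d"
      using 3 by (simp add: asymmetry_bound_def d_def)
    then show ?thesis
      using asymmetry_eq_bound[OF C(1), of d "2 * d"] swap_copula_diff[OF d(1,2)] C d by auto
  next
    case 2
    define d :: real where "d = 1 / 3"
    have d: "0 \<le> d" "d \<le> 1 / 3"
      by (auto simp: d_def)
    have C: "copula (swap_copula d)" "kendall_tau (swap_copula d) = 1 / 9"
      and D: "copula (antiswap_copula d)" "kendall_tau (antiswap_copula d) = - 5 / 9"
      using copula_swap[OF d] kendall_tau_swap[OF d] copula_antiswap[OF d] kendall_tau_antiswap[OF d]
      by (auto simp: d_def power2_eq_square)
    obtain p where p: "0 \<le> p" "p \<le> 1" "kendall_tau (mix_copula p (swap_copula d) (antiswap_copula d)) = \<tau>"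
      using kendall_tau_mix_surj[OF C(1) D(1), of \<tau>] C D 2 by auto
    let ?E = "mix_copula p (swap_copula d) (antiswap_copula d)"
    have E: "copula ?E"
      using C D p by (intro copula_mix)
    have "1 - d = 2 * d"
      by (simp add: d_def)
    with antiswap_copula_diff[OF d]
    have antiswap: "antiswap_copula d d (2 * d) - antiswap_copula d (2 * d) d = d"
      by (simp only:)
    have "?E d (2 * d) - ?E (2 * d) d = p * (swap_copula d d (2 * d) - swap_copula d (2 * d) d) +
        (1 - p) * (antiswap_copula d d (2 * d) - antiswap_copula d (2 * d) d)"
      by (simp add: mix_copula_def algebra_simps)
    also have "\<dots> = p * d + (1 - p) * d"
      by (simp only: swap_copula_diff[OF d] antiswap)
    finally have "?E d (2 * d) - ?E (2 * d) d = p * d + (1 - p) * d" .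
    moreover have "asymmetry_bound \<tau> = d"
      using 2 by (simp add: asymmetry_bound_def d_def)
    ultimately show ?thesis
      using asymmetry_eq_bound[OF E, of d "2 * d"] E p(3) d by (auto simp: algebra_simps)
  qed
qed

theorem corollary13:
  fixes \<tau> :: real
  shows "(\<forall>C. copula C \<and> kendall_tau C = \<tau> \<longrightarrow>
            0 \<le> asymmetry C \<and> asymmetry C \<le> asymmetry_bound \<tau>) \<and>
         (-1 \<le> \<tau> \<and> \<tau> \<le> 1 \<longrightarrow>
            (\<exists>C. copula C \<and> kendall_tau C = \<tau> \<and> asymmetry C = 0) \<and>
            (\<exists>C. copula C \<and> kendall_tau C = \<tau> \<and> asymmetry C = asymmetry_bound \<tau>))"
proof (intro conjI allI impI)
  fix C assume C: "copula C \<and> kendall_tau C = \<tau>"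
  show "0 \<le> asymmetry C"
    using asymmetry_ge[of C 0 0] C by simp
  show "asymmetry C \<le> asymmetry_bound \<tau>"
    using asymmetry_le_bound C by blast
qed (use ex_symmetric ex_asymmetry_bound in auto)

end
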